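(* Let $n \in \mathbb{N}$ and let $\nu, \tau, \gamma \in (0,1)$ satisfy $$4 \sqrt[13]{\frac{\log^2 n}{n}} < \nu \le \tau \le \frac{\gamma}{16} < \frac{1}{16}.$$ Let $D$ be an $n$-vertex digraph with $\delta^0(D) \geq \gamma n$ which is a robust $(\nu, \tau)$-outexpander. Then, for any integer $\ell$ with $\nu n/2 \le \ell \le n$ and any vertex $v$ of $D$, $D$ contains a directed cycle of length $\ell$ through $v$.
   Context: Digraphs are finite, have no loops, and have at most two edges between each pair of distinct vertices (at most one in each direction). $\delta^0(D)$ is the minimum semi-degree, i.e. the minimum of the minimum outdegree and the minimum indegree of $D$. Logarithms are base $e$. For an $n$-vertex digraph $D=(V,E)$, $\nu\in(0,1)$ and $S\subseteq V$, the robust $\nu$-outneighbourhood $\mathrm{RN}^+_\nu(S)$ is the set of vertices of $D$ that have at least $\nu n$ inneighbours in $S$. For $0<\nu\le\tau<1$, $D$ is a robust $(\nu,\tau)$-outexpander if $|\mathrm{RN}^+_\nu(S)|\ge |S|+\nu n$ for every $S\subseteq V$ with $\tau n\le |S|\le (1-\tau)n$. *)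

theory Defs
  imports Complex_Main "Graph_Theory.Graph_Theory"
begin

text \<open>
  Only meaningful for a finite digraph with at least one vertex, since \<^term>\<open>Min {}\<close> is unspecified.
\<close>
definition min_semi_degree :: "('a, 'b) pre_digraph \<Rightarrow> nat" where
  "min_semi_degree D = min (Min (out_degree D ` verts D)) (Min (in_degree D ` verts D))"

definition robust_out_nbhd :: "('a, 'b) pre_digraph \<Rightarrow> real \<Rightarrow> 'a set \<Rightarrow> 'a set" where
  "robust_out_nbhd D \<nu> S =
    {x \<in> verts D. real (card {y \<in> S. y \<rightarrow>\<^bsub>D\<^esub> x}) \<ge> \<nu> * real (card (verts D))}"

text \<open>The parameters are understood to satisfy \<^prop>\<open>0 < \<nu> \<and> \<nu> \<le> \<tau> \<and> \<tau> < (1::real)\<close>.\<close>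
definition robust_outexpander :: "real \<Rightarrow> real \<Rightarrow> ('a, 'b) pre_digraph \<Rightarrow> bool" where
  "robust_outexpander \<nu> \<tau> D \<longleftrightarrow>
    (\<forall>S \<subseteq> verts D.
       \<tau> * real (card (verts D)) \<le> real (card S) \<and>
       real (card S) \<le> (1 - \<tau>) * real (card (verts D)) \<longrightarrow>
       real (card (robust_out_nbhd D \<nu> S)) \<ge> real (card S) + \<nu> * real (card (verts D)))"

text \<open>
  \<^const>\<open>pre_digraph.cycle\<close> represents a directed cycle by its nonempty list of consecutive arcs, so
  its length is the number of arcs, and its vertices are exactly the tails of these arcs.
\<close>
definition has_cycle_through :: "('a, 'b) pre_digraph \<Rightarrow> int \<Rightarrow> 'a \<Rightarrow> bool" where
  "has_cycle_through D l v \<longleftrightarrow>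
    (\<exists>p. pre_digraph.cycle D p \<and> int (length p) = l \<and> v \<in> tail D ` set p)"

end

theory Submission
  imports Defs "HOL-Combinatorics.Permutations"
begin

text \<open>
  Absorption without regularity. Robust expansion survives in small random samples: if \<open>S\<close> and \<open>T\<close> lie
  in samples \<open>P\<close> and \<open>Q\<close> of size \<open>m\<close> of order \<open>\<nu>\<^sup>-\<^sup>3 log n\<close> and there is no arc from \<open>S\<close> to \<open>T\<close>, then a set
  of at most \<open>1/\<nu>\<close> vertices of \<open>T\<close> already determines supersets of \<open>S\<close> and \<open>T\<close> between which there are few
  arcs, so a union bound over these small sets gives \<open>|S| + |T| < m\<close>, with room to spare. By Hall's
  theorem any two samples are perfectly matched; so splitting the vertex set into disjoint samples
  covers it by at most \<open>2m\<close> paths.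

  An absorber for one path from \<open>u\<close> to \<open>w\<close> runs through an odd number of about \<open>4/\<nu>\<close> levels, the \<open>i\<close>-th of
  which contains all arcs of a perfect matching of two samples. Expansion between the levels yields
  one arc \<open>(a\<^sub>i, b\<^sub>i)\<close> on each level such that \<open>w b\<^sub>1\<close>, \<open>a\<^sub>i b\<^sub>i\<^sub>+\<^sub>1\<close> and the arc from the last \<open>a\<^sub>i\<close> to \<open>u\<close> exist, and
  exchanging arcs inserts the path. A short cycle made of \<open>2m + 1\<close> absorbers then swallows \<open>v\<close> and
  the paths covering the rest, truncated so as to reach the prescribed length.
\<close>

section \<open>Disjoint random samples\<close>

text \<open>All estimates are polynomial in \<open>1/\<nu>\<close>, and the size of the absorbing
  cycle decides which power is affordable. Put \<open>x = 1/\<nu>\<close> and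
  \<open>L = ln n\<close>. The number of fingerprints is \<open>n\<close> to a power of order
  \<open>x\<close>, and a sample must be accurate to within a multiple of \<open>1/x\<close>, so the
  union bound asks for \<open>m\<close> of order \<open>x^3 L\<close>. The \<open>2m + 1\<close>
  absorbers have about \<open>4x\<close> levels of \<open>m\<close> arcs, and each arc costs up to
  \<open>3x\<close> vertices including its connector: altogether order \<open>m^2 x^2\<close>, that
  is \<open>x^8 L^2\<close>. This must stay below \<open>\<nu> n / 2\<close>, both to keep expansion
  after deleting the cycle and to fit it into the shortest prescribed length. So \<open>n\<close>
  has to exceed a constant times \<open>x^9 L^2\<close>; the exponent 13 leaves \<open>x^4\<close>
  and \<open>4^13\<close> to pay for the constant. An absorber is not tied to ends chosen
  beforehand: expansion along its levels lets it take up any path disjoint from it. Hence the path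
  cover can be chosen after the absorbing cycle, from the vertices left over.\<close>

lemma binomial_ratio_le:
  fixes z n :: nat
  assumes "z \<le> n"
  shows "(z choose j) * n ^ j \<le> (n choose j) * z ^ j"
proof (induction j)
  case (Suc j)
  have A: "Suc j * (k choose Suc j) = (k choose j) * (k - j)" for k :: nat
    using binomial_absorb_comp[of k j] binomial_absorption[of j k]
    by (cases k) (auto simp: algebra_simps)
  have "(z - j) * n \<le> (n - j) * z"
    using mult_le_mono2[OF assms, of j]
    unfolding diff_mult_distrib mult.commute[of n z] by (rule diff_le_mono2)
  then have "((z choose j) * n ^ j) * ((z - j) * n) \<le> ((n choose j) * z ^ j) * ((n - j) * z)"
    using Suc by (rule mult_le_mono[rotated])
  then have "(Suc j * (z choose Suc j)) * n ^ Suc j \<le> (Suc j * (n choose Suc j)) * z ^ Suc j"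
    unfolding A by (simp add: mult_ac)
  then have "Suc j * ((z choose Suc j) * n ^ Suc j) \<le> Suc j * ((n choose Suc j) * z ^ Suc j)"
    by (simp only: mult.assoc)
  then show ?case by (simp only: Suc_mult_le_cancel1)
qed auto

lemma card_supersets_of_size:
  assumes "finite V" "J \<subseteq> V" "card J \<le> m"
  shows "card {W. W \<subseteq> V \<and> card W = m \<and> J \<subseteq> W} = (card V - card J) choose (m - card J)"
proof -
  have fJ: "finite J" using assms finite_subset by blast
  have "bij_betw (\<lambda>W. W \<union> J) {W. W \<subseteq> V - J \<and> card W = m - card J} {W. W \<subseteq> V \<and> card W = m \<and> J \<subseteq> W}"
  proof (rule bij_betw_byWitness[where f' = "\<lambda>W. W - J"])
    show "(\<lambda>W. W \<union> J) ` {W. W \<subseteq> V - J \<and> card W = m - card J} \<subseteq> {W. W \<subseteq> V \<and> card W = m \<and> J \<subseteq> W}"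
    proof safe
      fix W assume W: "W \<subseteq> V - J" "card W = m - card J"
      have "finite W" "W \<inter> J = {}" using W assms finite_subset by blast+
      then show "card (W \<union> J) = m" using W assms fJ by (simp add: card_Un_disjoint)
    qed (use assms in auto)
    show "(\<lambda>W. W - J) ` {W. W \<subseteq> V \<and> card W = m \<and> J \<subseteq> W} \<subseteq> {W. W \<subseteq> V - J \<and> card W = m - card J}"
      using fJ by (auto simp: card_Diff_subset)
  qed auto
  then have "card {W. W \<subseteq> V \<and> card W = m \<and> J \<subseteq> W} = card {W. W \<subseteq> V - J \<and> card W = m - card J}"
    by (simp add: bij_betw_same_card)
  also have "\<dots> = (card V - card J) choose (m - card J)"
    using assms fJ by (subst n_subsets) (auto simp: card_Diff_subset)
  finally show ?thesis .
qed

text \<open>Double counting of the pairs \<open>J \<subseteq> Z \<inter> W\<close> with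
  \<open>card J = j\<close>. Up to normalisation these are the factorial moments of a hypergeometric
  variable.\<close>

lemma sum_choose_Int:
  assumes "finite V" "Z \<subseteq> V" "j \<le> m"
  shows "(\<Sum>W | W \<subseteq> V \<and> card W = m. card (Z \<inter> W) choose j)
    = (card Z choose j) * ((card V - j) choose (m - j))"
proof -
  let ?\<W> = "{W. W \<subseteq> V \<and> card W = m}" and ?\<J> = "{J. J \<subseteq> Z \<and> card J = j}"
  have fZ: "finite Z" using assms finite_subset by blast
  have fin: "finite ?\<W>" "finite ?\<J>" using assms fZ by auto
  have "card (Z \<inter> W) choose j = (\<Sum>J | J \<in> ?\<J> \<and> J \<subseteq> W. 1)" for W
  proof -
    have "card (Z \<inter> W) choose j = card {J. J \<subseteq> Z \<inter> W \<and> card J = j}"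
      using n_subsets[of "Z \<inter> W" j] fZ by simp
    also have "{J. J \<subseteq> Z \<inter> W \<and> card J = j} = {J. J \<in> ?\<J> \<and> J \<subseteq> W}" by auto
    finally show ?thesis by simp
  qed
  then have "(\<Sum>W\<in>?\<W>. card (Z \<inter> W) choose j) = (\<Sum>W\<in>?\<W>. \<Sum>J | J \<in> ?\<J> \<and> J \<subseteq> W. 1)" by simp
  also have "\<dots> = (\<Sum>J\<in>?\<J>. \<Sum>W | W \<in> ?\<W> \<and> J \<subseteq> W. 1)"
    using fin by (rule sum.swap_restrict)
  also have "\<dots> = (\<Sum>J\<in>?\<J>. (card V - j) choose (m - j))"
  proof (rule sum.cong[OF refl])
    fix J assume J: "J \<in> ?\<J>"
    have "{W. W \<in> ?\<W> \<and> J \<subseteq> W} = {W. W \<subseteq> V \<and> card W = m \<and> J \<subseteq> W}" by auto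
    then show "(\<Sum>W | W \<in> ?\<W> \<and> J \<subseteq> W. 1) = (card V - j) choose (m - j)"
      using card_supersets_of_size[of V J m] J assms by auto
  qed
  also have "\<dots> = (card Z choose j) * ((card V - j) choose (m - j))"
    using fZ by (simp add: n_subsets)
  finally show ?thesis .
qed

text \<open>Sampling without replacement is dominated by sampling with replacement. Expanding in
  powers of \<open>x \<ge> 0\<close> turns both sides into sums of factorial moments, and
  \<open>binomial_ratio_le\<close> compares them term by term.\<close>

lemma sum_power_card_Int_le:
  fixes x :: real
  assumes "finite V" "Z \<subseteq> V" "m \<le> card V" "0 < card V" "0 \<le> x"
  shows "(\<Sum>W | W \<subseteq> V \<and> card W = m. (1 + x) ^ card (Z \<inter> W))
    \<le> (card V choose m) * (1 + real (card Z) / card V * x) ^ m"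
proof -
  let ?\<W> = "{W. W \<subseteq> V \<and> card W = m}" and ?n = "card V" and ?z = "card Z"
  have zn: "?z \<le> ?n" using assms by (simp add: card_mono)
  have "(1 + x) ^ card (Z \<inter> W) = (\<Sum>j\<le>m. (card (Z \<inter> W) choose j) * x ^ j)" if "W \<in> ?\<W>" for W
  proof -
    have "finite W" using that assms finite_subset by blast
    then have le: "card (Z \<inter> W) \<le> m" using that card_mono[of W "Z \<inter> W"] by auto
    have "(1 + x) ^ card (Z \<inter> W) = (\<Sum>j\<le>card (Z \<inter> W). (card (Z \<inter> W) choose j) * x ^ j)"
      using binomial_ring[of x 1 "card (Z \<inter> W)"] by (simp add: add.commute)
    also have "\<dots> = (\<Sum>j\<le>m. (card (Z \<inter> W) choose j) * x ^ j)"
      using le by (intro sum.mono_neutral_left) auto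
    finally show ?thesis .
  qed
  then have "(\<Sum>W\<in>?\<W>. (1 + x) ^ card (Z \<inter> W)) = (\<Sum>W\<in>?\<W>. \<Sum>j\<le>m. (card (Z \<inter> W) choose j) * x ^ j)"
    by simp
  also have "\<dots> = (\<Sum>j\<le>m. real (\<Sum>W\<in>?\<W>. card (Z \<inter> W) choose j) * x ^ j)"
    by (subst sum.swap) (simp add: sum_distrib_right)
  also have "\<dots> \<le> (\<Sum>j\<le>m. real (?n choose m) * (real (m choose j) * (?z / ?n * x) ^ j))"
  proof (rule sum_mono)
    fix j assume j: "j \<in> {..m}"
    have "(?z choose j) * ((?n - j) choose (m - j)) * ?n ^ j \<le> (?n choose j) * ((?n - j) choose (m - j)) * ?z ^ j"
      using mult_le_mono1[OF binomial_ratio_le[OF zn, of j], of "(?n - j) choose (m - j)"]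
      by (simp add: mult_ac)
    also have "\<dots> = (?n choose m) * (m choose j) * ?z ^ j"
      using choose_mult[of j m ?n] j assms by simp
    finally have "real ((?z choose j) * ((?n - j) choose (m - j))) * real ?n ^ j
        \<le> real ((?n choose m) * (m choose j)) * real ?z ^ j"
      by (metis of_nat_le_iff of_nat_mult of_nat_power)
    then have "real ((?z choose j) * ((?n - j) choose (m - j))) \<le> real ((?n choose m) * (m choose j)) * (?z / ?n) ^ j"
      using assms by (simp add: power_divide pos_le_divide_eq)
    then have "real ((?z choose j) * ((?n - j) choose (m - j))) * x ^ j
        \<le> real ((?n choose m) * (m choose j)) * (?z / ?n) ^ j * x ^ j"
      using assms by (intro mult_right_mono) auto
    then show "real (\<Sum>W\<in>?\<W>. card (Z \<inter> W) choose j) * x ^ j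
        \<le> real (?n choose m) * (real (m choose j) * (?z / ?n * x) ^ j)"
      using sum_choose_Int[of V Z j m] j assms by (simp add: power_mult_distrib mult_ac power_divide)
  qed
  also have "\<dots> = real (?n choose m) * (1 + ?z / ?n * x) ^ m"
    using binomial_ring[of "?z / ?n * x" 1 m] by (simp add: sum_distrib_left add.commute)
  finally show ?thesis .
qed

text \<open>Chernoff's upper tail bound, with counting in place of probabilities: weight each
  \<open>W\<close> by \<open>exp \<theta>\<close> to the power
  \<open>card (Z \<inter> W)\<close>.\<close>

lemma card_large_Int_le:
  fixes \<delta> :: real
  assumes "finite V" "Z \<subseteq> V" "m \<le> card V" "0 < card V" "0 \<le> \<delta>" "\<delta> \<le> 1"
  shows "card {W. W \<subseteq> V \<and> card W = m \<and> real (card (Z \<inter> W)) > real (card Z) / card V * m + \<delta> * m}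
    \<le> (card V choose m) * exp (- (\<delta>\<^sup>2 * m / 4))"
proof -
  define p where "p = real (card Z) / card V"
  have p: "0 \<le> p" "p \<le> 1" using assms by (auto simp: p_def card_mono)
  \<comment> \<open>The exponent will be \<open>(\<theta>^2 - \<theta> \<delta>) m\<close>, which is
    least at this value.\<close>
  define \<theta> where "\<theta> = \<delta> / 2"
  have th: "0 \<le> \<theta>" "\<theta> \<le> 1" using assms by (auto simp: \<theta>_def)
  let ?\<W> = "{W. W \<subseteq> V \<and> card W = m}"
  let ?B = "{W. W \<subseteq> V \<and> card W = m \<and> real (card (Z \<inter> W)) > p * m + \<delta> * m}"
  have "real (card ?B) * exp (\<theta> * (p * m + \<delta> * m)) = (\<Sum>W\<in>?B. exp (\<theta> * (p * m + \<delta> * m)))" by simp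
  also have "\<dots> \<le> (\<Sum>W\<in>?B. (1 + (exp \<theta> - 1)) ^ card (Z \<inter> W))"
  proof (rule sum_mono)
    fix W assume "W \<in> ?B"
    then have "\<theta> * (p * m + \<delta> * m) \<le> \<theta> * card (Z \<inter> W)" using th by (intro mult_left_mono) auto
    then show "exp (\<theta> * (p * m + \<delta> * m)) \<le> (1 + (exp \<theta> - 1)) ^ card (Z \<inter> W)"
      by (simp flip: exp_of_nat2_mult)
  qed
  also have "\<dots> \<le> (\<Sum>W\<in>?\<W>. (1 + (exp \<theta> - 1)) ^ card (Z \<inter> W))"
    using assms by (intro sum_mono2) auto
  also have "\<dots> \<le> (card V choose m) * (1 + p * (exp \<theta> - 1)) ^ m"
    unfolding p_def using th by (intro sum_power_card_Int_le assms) auto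
  also have "\<dots> \<le> (card V choose m) * exp (p * \<theta> + \<theta>\<^sup>2) ^ m"
  proof (intro mult_left_mono power_mono)
    have "1 + p * (exp \<theta> - 1) \<le> 1 + p * (\<theta> + \<theta>\<^sup>2)"
      using exp_bound[OF th] p by (intro add_left_mono mult_left_mono) auto
    also have "\<dots> \<le> 1 + (p * \<theta> + \<theta>\<^sup>2)"
      using p mult_right_mono[of p 1 "\<theta>\<^sup>2"] by (simp add: algebra_simps)
    also have "\<dots> \<le> exp (p * \<theta> + \<theta>\<^sup>2)" by (rule exp_ge_add_one_self)
    finally show "1 + p * (exp \<theta> - 1) \<le> exp (p * \<theta> + \<theta>\<^sup>2)" .
  qed (use p th in auto)
  also have "exp (p * \<theta> + \<theta>\<^sup>2) ^ m = exp (- (\<delta>\<^sup>2 * m / 4)) * exp (\<theta> * (p * m + \<delta> * m))"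
    unfolding exp_of_nat_mult[symmetric] exp_add[symmetric] \<theta>_def
    by (simp add: field_simps power2_eq_square)
  finally have "real (card ?B) * exp (\<theta> * (p * m + \<delta> * m))
    \<le> (card V choose m) * exp (- (\<delta>\<^sup>2 * m / 4)) * exp (\<theta> * (p * m + \<delta> * m))"
    by (simp add: mult.assoc)
  then show ?thesis unfolding p_def by simp
qed

section \<open>Disjoint uniform sets from a random permutation\<close>

lemma permutes_image_exists:
  assumes "finite V" "A \<subseteq> V" "B \<subseteq> V" "card A = card B"
  shows "\<exists>p. p permutes V \<and> p ` A = B"
proof -
  have fin: "finite A" "finite B" using assms finite_subset by blast+
  obtain f where f: "bij_betw f A B" using assms fin finite_same_card_bij by blast
  have "card (V - A) = card (V - B)" using assms fin by (simp add: card_Diff_subset)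
  then obtain g where g: "bij_betw g (V - A) (V - B)"
    using assms finite_same_card_bij[of "V - A" "V - B"] by auto
  define p where "p x = (if x \<in> A then f x else if x \<in> V then g x else x)" for x
  have 1: "bij_betw p A B" using f by (rule bij_betw_cong[THEN iffD1, rotated]) (auto simp: p_def)
  have 2: "bij_betw p (V - A) (V - B)" using g by (rule bij_betw_cong[THEN iffD1, rotated]) (auto simp: p_def)
  have "bij_betw p (A \<union> (V - A)) (B \<union> (V - B))" using 1 2 by (rule bij_betw_combine) auto
  then have "bij_betw p V V" using assms by (simp add: Un_absorb1)
  then have "p permutes V" by (rule bij_imp_permutes) (use assms in \<open>auto simp: p_def\<close>)
  then show ?thesis using 1 by (auto simp: bij_betw_def)
qed

text \<open>Composition with a permutation carrying \<open>W\<close> to \<open>W'\<close> is a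
  bijection between the two sets. Thus the image of a fixed set under a uniform permutation is
  uniform among the sets of its size.\<close>

lemma card_permutes_image_eq:
  assumes "finite V" "A \<subseteq> V" "W \<subseteq> V" "card W = card A" "W' \<subseteq> V" "card W' = card A"
  shows "card {p. p permutes V \<and> p ` A = W} = card {p. p permutes V \<and> p ` A = W'}"
proof -
  obtain q where q: "q permutes V" "q ` W = W'" using permutes_image_exists[of V W W'] assms by auto
  have inv: "inv q ` W' = W" using q by (metis bij_betw_imp_inj_on image_inv_f_f permutes_bij)
  have im: "(f \<circ> p) ` A = f ` p ` A" for f p :: "'a \<Rightarrow> 'a" by (simp only: image_comp)
  have "bij_betw (\<lambda>p. q \<circ> p) {p. p permutes V \<and> p ` A = W} {p. p permutes V \<and> p ` A = W'}"
  proof (rule bij_betw_byWitness[where f' = "\<lambda>p. inv q \<circ> p"])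
    have "q \<circ> p permutes V \<and> (q \<circ> p) ` A = W'" if "p permutes V" "p ` A = W" for p
      using that q unfolding im by (simp add: permutes_compose)
    then show "(\<lambda>p. q \<circ> p) ` {p. p permutes V \<and> p ` A = W} \<subseteq> {p. p permutes V \<and> p ` A = W'}"
      by blast
    have "inv q \<circ> p permutes V \<and> (inv q \<circ> p) ` A = W" if "p permutes V" "p ` A = W'" for p
      using that q(1) inv unfolding im by (simp add: permutes_compose permutes_inv)
    then show "(\<lambda>p. inv q \<circ> p) ` {p. p permutes V \<and> p ` A = W'} \<subseteq> {p. p permutes V \<and> p ` A = W}"
      by blast
  qed (use q in \<open>auto simp: o_assoc permutes_inv_o\<close>)
  then show ?thesis by (rule bij_betw_same_card)
qed

text \<open>Fix \<open>k\<close> disjoint blocks and move them by a random permutation: disjointness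
  is inherited, while each single image is a uniform \<open>m\<close>-set and so lies in
  \<open>G\<close> with probability \<open>card G / (card V choose m)\<close>. The union bound over
  the blocks leaves a good permutation.\<close>

lemma disjoint_avoiding_family:
  assumes fin: "finite V" and km: "k * m \<le> card V"
    and G: "G \<subseteq> {W. W \<subseteq> V \<and> card W = m}" "k * card G < card V choose m"
  shows "\<exists>W. (\<forall>i<k. W i \<subseteq> V \<and> card (W i) = m \<and> W i \<notin> G) \<and>
    (\<forall>i<k. \<forall>j<k. i \<noteq> j \<longrightarrow> W i \<inter> W j = {})"
proof -
  obtain e where e: "bij_betw e {0..<card V} V" using ex_bij_betw_nat_finite[OF fin] by blast
  define B where "B i = e ` {i * m..<i * m + m}" for i
  have sub: "{i * m..<i * m + m} \<subseteq> {0..<card V}" if "i < k" for i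
  proof -
    have "Suc i * m \<le> k * m" using that by (intro mult_le_mono1) auto
    then have "i * m + m \<le> card V" using km by simp
    then show ?thesis by auto
  qed
  have inj: "inj_on e {0..<card V}" using e by (simp add: bij_betw_def)
  have BV: "B i \<subseteq> V" "card (B i) = m" if "i < k" for i
    using sub[OF that] e inj unfolding B_def bij_betw_def
    by (auto simp: card_image inj_on_subset)
  have Bdisj: "B i \<inter> B j = {}" if "i < k" "j < k" "i \<noteq> j" for i j
  proof -
    have "{i * m..<i * m + m} \<inter> {j * m..<j * m + m} = {}"
    proof -
      have "i = j" if "x \<in> {i * m..<i * m + m}" "x \<in> {j * m..<j * m + m}" for x
      proof -
        have "x div m = i" "x div m = j" using that
          by (auto intro!: div_nat_eqI simp: algebra_simps)
        then show ?thesis by simp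
      qed
      then show ?thesis using that by blast
    qed
    then show ?thesis unfolding B_def using inj_on_image_Int[OF inj sub[OF that(1)] sub[OF that(2)]] by auto
  qed
  define PP where "PP = {p. p permutes V}"
  have fP: "finite PP" unfolding PP_def using fin by (rule finite_permutations)
  let ?\<W> = "{W. W \<subseteq> V \<and> card W = m}"
  have fW: "finite ?\<W>" using fin by auto
  have bad: "card {p\<in>PP. p ` B i \<in> G} * (card V choose m) = card G * card PP" if i: "i < k" for i
  proof -
    define c where "c W = card {p\<in>PP. p ` B i = W}" for W
    have ceq: "c W = c (B i)" if "W \<in> ?\<W>" for W
      unfolding c_def PP_def using card_permutes_image_eq[OF fin, of "B i" W "B i"] BV[OF i] that by auto
    have fib: "card {p\<in>PP. p ` B i \<in> H} = card H * c (B i)" if H: "H \<subseteq> ?\<W>" for H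
    proof -
      have fH: "finite H" using H fW finite_subset by blast
      have "{p\<in>PP. p ` B i \<in> H} = (\<Union>W\<in>H. {p\<in>PP. p ` B i = W})" by auto
      then have "card {p\<in>PP. p ` B i \<in> H} = (\<Sum>W\<in>H. c W)"
        unfolding c_def using fH fP by (simp only:) (subst card_UN_disjoint; auto)
      also have "\<dots> = card H * c (B i)" using ceq H by (simp add: subset_iff)
      finally show ?thesis .
    qed
    have "{p\<in>PP. p ` B i \<in> ?\<W>} = PP"
    proof -
      have "p ` B i \<in> ?\<W>" if "p \<in> PP" for p
        using that BV[OF i] unfolding PP_def
        by (auto simp: permutes_in_image card_image permutes_inj_on)
      then show ?thesis by auto
    qed
    then have "card PP = (card V choose m) * c (B i)"
      using fib[of ?\<W>] n_subsets[OF fin, of m] by simp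
    then show ?thesis using fib[OF G(1)] by simp
  qed
  have "\<exists>p\<in>PP. \<forall>i<k. p ` B i \<notin> G"
  proof (rule ccontr)
    assume "\<not> ?thesis"
    then have "PP \<subseteq> (\<Union>i<k. {p\<in>PP. p ` B i \<in> G})" by auto
    then have "card PP \<le> card (\<Union>i<k. {p\<in>PP. p ` B i \<in> G})" using fP by (intro card_mono) auto
    also have "\<dots> \<le> (\<Sum>i<k. card {p\<in>PP. p ` B i \<in> G})" by (rule card_UN_le) auto
    finally have "card PP * (card V choose m) \<le> (\<Sum>i<k. card {p\<in>PP. p ` B i \<in> G}) * (card V choose m)"
      by (rule mult_le_mono1)
    also have "\<dots> = (\<Sum>i<k. card G * card PP)"
      unfolding sum_distrib_right using bad by (intro sum.cong) auto
    also have "\<dots> = card PP * (k * card G)" by simp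
    finally have "card PP * (card V choose m) \<le> card PP * (k * card G)" .
    moreover have "card PP > 0" using fP permutes_id[of V] unfolding PP_def by (auto simp: card_gt_0_iff simp del: permutes_id)
    ultimately show False using G(2) by simp
  qed
  then obtain p where p: "p permutes V" "\<And>i. i < k \<Longrightarrow> p ` B i \<notin> G" unfolding PP_def by auto
  have "p ` B i \<inter> p ` B j = {}" if "i < k" "j < k" "i \<noteq> j" for i j
    using Bdisj[OF that] image_Int[OF permutes_inj[OF p(1)], of "B i" "B j"] by simp
  moreover have "p ` B i \<subseteq> V" "card (p ` B i) = m" if "i < k" for i
    using BV[OF that] p(1) permutes_image[OF p(1)] by (auto simp: card_image permutes_inj_on)
  ultimately show ?thesis using p(2) by (intro exI[of _ "\<lambda>i. p ` B i"]) auto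
qed

lemma disjoint_samples_exist:
  fixes \<delta> :: real
  assumes fin: "finite V" "0 < card V" and km: "k * m \<le> card V"
    and F: "finite \<F>" "\<And>Z. Z \<in> \<F> \<Longrightarrow> Z \<subseteq> V" and d: "0 \<le> \<delta>" "\<delta> \<le> 1"
    and small: "k * card \<F> * exp (- (\<delta>\<^sup>2 * m / 4)) < 1"
  shows "\<exists>W. (\<forall>i<k. W i \<subseteq> V \<and> card (W i) = m \<and>
      (\<forall>Z\<in>\<F>. real (card (Z \<inter> W i)) \<le> real (card Z) / card V * m + \<delta> * m)) \<and>
    (\<forall>i<k. \<forall>j<k. i \<noteq> j \<longrightarrow> W i \<inter> W j = {})"
proof (cases "k = 0")
  case False
  then have mV: "m \<le> card V" using km by (metis dual_order.trans le_square mult.commute mult_le_mono1 nat_mult_1 One_nat_def Suc_leI neq0_conv)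
  let ?B = "\<lambda>Z. {W. W \<subseteq> V \<and> card W = m \<and> real (card (Z \<inter> W)) > real (card Z) / card V * m + \<delta> * m}"
  define G where "G = (\<Union>Z\<in>\<F>. ?B Z)"
  have "real (card G) \<le> (\<Sum>Z\<in>\<F>. real (card (?B Z)))"
    unfolding G_def using card_UN_le[OF F(1), of ?B] by (simp flip: of_nat_sum)
  also have "\<dots> \<le> (\<Sum>Z\<in>\<F>. (card V choose m) * exp (- (\<delta>\<^sup>2 * m / 4)))"
    using F(2) by (intro sum_mono card_large_Int_le fin d mV)
  finally have "real k * real (card G) \<le> (card V choose m) * (k * card \<F> * exp (- (\<delta>\<^sup>2 * m / 4)))"
    by (simp add: mult_left_mono mult_ac)
  also have "\<dots> < real (card V choose m) * 1"
    using small mV by (intro mult_strict_left_mono) auto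
  finally have "k * card G < card V choose m" by (simp flip: of_nat_mult)
  moreover have "G \<subseteq> {W. W \<subseteq> V \<and> card W = m}" by (auto simp: G_def)
  ultimately obtain W where "\<forall>i<k. W i \<subseteq> V \<and> card (W i) = m \<and> W i \<notin> G"
    "\<forall>i<k. \<forall>j<k. i \<noteq> j \<longrightarrow> W i \<inter> W j = {}"
    using disjoint_avoiding_family[OF fin(1) km] by blast
  then show ?thesis by (intro exI[of _ W]) (auto simp: G_def not_less)
qed auto

section \<open>Expansion within samples\<close>

text \<open>Induction in the style of Halmos and Vaughan. A tight proper subset is matched on its
  own and its neighbours are removed for the rest; if none is tight, any one element may take any of
  its neighbours, since the strict inequality pays for the loss.\<close>

lemma hall_marriage:
  assumes "finite P" "\<And>x. x \<in> P \<Longrightarrow> finite (N x)"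
    and "\<And>S. S \<subseteq> P \<Longrightarrow> card S \<le> card (\<Union>x\<in>S. N x)"
  shows "\<exists>f. inj_on f P \<and> (\<forall>x\<in>P. f x \<in> N x)"
  using assms
proof (induction P arbitrary: N rule: finite_psubset_induct)
  case (psubset P)
  show ?case
  proof (cases "\<exists>S. S \<subset> P \<and> S \<noteq> {} \<and> card (\<Union>x\<in>S. N x) \<le> card S")
    case True
    then obtain S where S: "S \<subset> P" "S \<noteq> {}" "card (\<Union>x\<in>S. N x) \<le> card S" by blast
    have fS: "finite S" using S psubset.hyps finite_subset by blast
    have "\<exists>f. inj_on f S \<and> (\<forall>x\<in>S. f x \<in> N x)"
      using S(1) psubset.prems by (intro psubset.IH) (auto dest: subset_trans)
    then obtain f where f: "inj_on f S" "\<And>x. x \<in> S \<Longrightarrow> f x \<in> N x" by blast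
    let ?N = "\<lambda>x. N x - (\<Union>x\<in>S. N x)"
    have "\<exists>g. inj_on g (P - S) \<and> (\<forall>x\<in>P - S. g x \<in> ?N x)"
    proof (rule psubset.IH)
      show "card T \<le> card (\<Union>x\<in>T. ?N x)" if T: "T \<subseteq> P - S" for T
      proof -
        have fT: "finite T" using T psubset.hyps finite_subset by blast
        have "card S + card T = card (S \<union> T)" using fS fT T by (subst card_Un_disjoint) auto
        also have "\<dots> \<le> card (\<Union>x\<in>S \<union> T. N x)" using S T by (intro psubset.prems) auto
        also have "(\<Union>x\<in>S \<union> T. N x) = (\<Union>x\<in>S. N x) \<union> (\<Union>x\<in>T. ?N x)" by auto
        also have "card \<dots> \<le> card (\<Union>x\<in>S. N x) + card (\<Union>x\<in>T. ?N x)" by (rule card_Un_le)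
        finally show ?thesis using S(3) by simp
      qed
    qed (use S psubset.prems in auto)
    then obtain g where g: "inj_on g (P - S)" "\<And>x. x \<in> P - S \<Longrightarrow> g x \<in> ?N x" by blast
    let ?h = "\<lambda>x. if x \<in> S then f x else g x"
    have "?h x \<noteq> ?h y" if "x \<in> S" "y \<in> P - S" for x y
      using f(2)[OF that(1)] g(2)[OF that(2)] that by auto
    then have "inj_on ?h P"
      using f(1) g(1) unfolding inj_on_def by (metis DiffI)
    moreover have "\<forall>x\<in>P. ?h x \<in> N x" using f(2) g(2) by auto
    ultimately show ?thesis by blast
  next
    case False
    then have strict: "card S < card (\<Union>x\<in>S. N x)" if "S \<subset> P" "S \<noteq> {}" for S
      using that by (meson not_less)
    show ?thesis
    proof (cases "P = {}")
      case False
      then obtain x where x: "x \<in> P" by blast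
      have "N x \<noteq> {}" using psubset.prems(2)[of "{x}"] x by auto
      then obtain y where y: "y \<in> N x" by blast
      have "\<exists>f. inj_on f (P - {x}) \<and> (\<forall>z\<in>P - {x}. f z \<in> N z - {y})"
      proof (rule psubset.IH)
        show "card S \<le> card (\<Union>z\<in>S. N z - {y})" if S: "S \<subseteq> P - {x}" for S
        proof (cases "S = {}")
          case False
          have "finite S" using S psubset.hyps finite_subset by blast
          then have "finite (\<Union>z\<in>S. N z)" using S psubset.prems by blast
          moreover have "card S < card (\<Union>z\<in>S. N z)" using S x False by (intro strict) auto
          moreover have "(\<Union>z\<in>S. N z - {y}) = (\<Union>z\<in>S. N z) - {y}" by auto
          ultimately show ?thesis by (auto simp: card_Diff_singleton_if)
        qed simp
      qed (use x psubset.prems in auto)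
      then obtain f where f: "inj_on f (P - {x})" "\<And>z. z \<in> P - {x} \<Longrightarrow> f z \<in> N z - {y}" by blast
      have "inj_on (f(x := y)) (insert x (P - {x}))"
        using f by (subst inj_on_insert) (auto simp: inj_on_def)
      then have "inj_on (f(x := y)) P" using x by (simp add: insert_absorb)
      moreover have "\<forall>z\<in>P. (f(x := y)) z \<in> N z" using f y by auto
      ultimately show ?thesis by blast
    qed auto
  qed
qed

lemma card_small_subsets_le:
  assumes "finite V"
  shows "finite {T. T \<subseteq> V \<and> card T \<le> q}" "card {T. T \<subseteq> V \<and> card T \<le> q} \<le> card V ^ q + 1"
proof -
  let ?L = "{xs. set xs \<subseteq> V \<and> length xs = q}"
  have sub: "{T. T \<subseteq> V \<and> card T \<le> q} \<subseteq> insert {} (set ` ?L)"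
  proof
    fix T assume T: "T \<in> {T. T \<subseteq> V \<and> card T \<le> q}"
    show "T \<in> insert {} (set ` ?L)"
    proof (cases "T = {}")
      case False
      then obtain x where x: "x \<in> T" by blast
      have "finite T" using T assms finite_subset by blast
      then obtain xs where xs: "set xs = T" "distinct xs" using finite_distinct_list by blast
      then have "length xs = card T" by (metis distinct_card)
      \<comment> \<open>Repeating an element pads the list to length exactly \<open>q\<close>
        without changing its set; only the empty set cannot be padded, hence the extra 1.\<close>
      then have "xs @ replicate (q - card T) x \<in> ?L" "set (xs @ replicate (q - card T) x) = T"
        using T xs x by auto
      then show ?thesis by blast
    qed simp
  qed
  have fL: "finite ?L" using assms by (rule finite_lists_length_eq)
  show "finite {T. T \<subseteq> V \<and> card T \<le> q}" using assms by auto
  have "card {T. T \<subseteq> V \<and> card T \<le> q} \<le> card (insert {} (set ` ?L))"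
    using sub fL by (intro card_mono) auto
  also have "\<dots> \<le> Suc (card (set ` ?L))" using fL by (simp add: card_insert_if)
  also have "\<dots> \<le> Suc (card ?L)" using fL by (simp add: card_image_le)
  finally show "card {T. T \<subseteq> V \<and> card T \<le> q} \<le> card V ^ q + 1"
    using card_lists_length_eq[OF assms, of q] by simp
qed

text \<open>Expansion in absolute numbers, stated so that it survives deletion of vertices. It
  bounds the complement of the robust outneighbourhood; the alternative of an empty complement
  covers very large \<open>X\<close>, so no upper bound on \<open>X\<close> has to be carried along.
  The \<open>lo\<close> in \<open>outdeg\<close> serves the sets too small for
  \<open>robust\<close>.\<close>

locale robust_system =
  fixes V :: "'a set" and E :: "'a \<Rightarrow> 'a \<Rightarrow> bool" and b c lo :: real
  assumes finite_V: "finite V" and V_nonempty: "V \<noteq> {}" and b_pos: "0 < b" and c_pos: "0 < c"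
    and robust: "X \<subseteq> V \<Longrightarrow> lo \<le> card X \<Longrightarrow>
      {y \<in> V. real (card {x \<in> X. E x y}) < b} = {} \<or>
      real (card {y \<in> V. real (card {x \<in> X. E x y}) < b}) + card X \<le> card V - c"
    and outdeg: "x \<in> V \<Longrightarrow> lo + c \<le> card {y \<in> V. E x y}"
    and indeg: "y \<in> V \<Longrightarrow> c \<le> card {x \<in> V. E x y}"
begin

definition few :: "'a set \<Rightarrow> 'a set" where
  "few X = {y \<in> V. real (card {x \<in> X. E x y}) < b}"

definition nonadj :: "'a set \<Rightarrow> 'a set" where
  "nonadj T = {x \<in> V. \<forall>y\<in>T. \<not> E x y}"

text \<open>Sets in which a sample must not be overrepresented: the two sides determined by each
  possible fingerprint, and the nonneighbourhoods of single vertices. Taking nonneighbourhoods makes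
  an upper tail bound enough for lower bounds on degrees into a sample as well.\<close>

definition test_sets :: "'a set set" where
  "test_sets = (let \<T> = {T. T \<subseteq> V \<and> card T \<le> nat \<lfloor>card V / b\<rfloor>} in
     nonadj ` \<T> \<union> few ` nonadj ` \<T> \<union> (\<lambda>x. {y \<in> V. \<not> E x y}) ` V \<union> (\<lambda>y. {x \<in> V. \<not> E x y}) ` V)"

text \<open>The error is a quarter of the expansion gap \<open>c / card V\<close>: \<open>S\<close>
  and \<open>T\<close> each spend it once, and half of the gap remains.\<close>

definition sample :: "nat \<Rightarrow> 'a set \<Rightarrow> bool" where
  "sample m W \<longleftrightarrow> W \<subseteq> V \<and> card W = m \<and>
     (\<forall>Z\<in>test_sets. real (card (Z \<inter> W)) \<le> real (card Z) / card V * m + c / (4 * card V) * m)"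

lemma card_V_pos: "0 < card V"
  using finite_V V_nonempty by (simp add: card_gt_0_iff)

lemma c_le_card: "c \<le> card V"
proof -
  obtain y where "y \<in> V" using V_nonempty by blast
  then have "c \<le> card {x \<in> V. E x y}" by (rule indeg)
  also have "\<dots> \<le> card V" using finite_V by (simp add: card_mono)
  finally show ?thesis .
qed

text \<open>The set \<open>T\<^sub>0\<close> is a fingerprint: it has few possible values, and it already confines both
  sides of a pair without arcs between them.\<close>
lemma fingerprint_exists:
  assumes T: "T \<subseteq> V"
  shows "\<exists>T0. T0 \<subseteq> T \<and> card T0 \<le> nat \<lfloor>card V / b\<rfloor> \<and> T \<subseteq> few (nonadj T0)"
proof -
  have fT: "finite T" using T finite_V finite_subset by blast
  \<comment> \<open>Greedy choice: a vertex \<open>y\<close> of \<open>T\<close> with at least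
    \<open>b\<close> inneighbours in \<open>nonadj T0\<close> can be added, and then
    \<open>nonadj\<close> loses at least \<open>b\<close> elements. A largest \<open>T0\<close>
    therefore leaves no such \<open>y\<close>, and \<open>card T0 * b \<le> card V\<close> limits
    its size.\<close>
  define P where "P T0 \<longleftrightarrow> T0 \<subseteq> T \<and> card T0 * b + card (nonadj T0) \<le> card V" for T0
  have "P {}" by (simp add: P_def nonadj_def)
  moreover have "\<forall>T0. P T0 \<longrightarrow> card T0 < Suc (card T)"
    using fT by (auto simp: P_def card_mono less_Suc_eq_le)
  ultimately obtain T0 where T0: "P T0" and max: "\<And>T1. P T1 \<Longrightarrow> card T1 \<le> card T0"
    using ex_has_greatest_nat[of P "{}" card "Suc (card T)"] by auto
  have fin: "finite T0" "finite (nonadj T0)"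
    using T0 fT finite_V finite_subset by (auto simp: P_def nonadj_def)
  have "T \<subseteq> few (nonadj T0)"
  proof (rule ccontr)
    assume "\<not> ?thesis"
    then obtain y where y: "y \<in> T" "b \<le> card {x \<in> nonadj T0. E x y}"
      using T unfolding few_def by force
    have "y \<notin> T0"
    proof
      assume "y \<in> T0"
      then have none: "{x \<in> nonadj T0. E x y} = {}" by (auto simp: nonadj_def)
      show False using y(2) b_pos unfolding none by simp
    qed
    have split: "nonadj T0 = nonadj (insert y T0) \<union> {x \<in> nonadj T0. E x y}"
      by (auto simp: nonadj_def)
    have "card (nonadj T0) = card (nonadj (insert y T0)) + card {x \<in> nonadj T0. E x y}"
      using fin by (subst split, subst card_Un_disjoint) (auto simp: nonadj_def finite_V)
    then have "P (insert y T0)"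
      using T0 y \<open>y \<notin> T0\<close> fin unfolding P_def by (auto simp: algebra_simps)
    from max[OF this] show False using \<open>y \<notin> T0\<close> fin by simp
  qed
  moreover have "card T0 \<le> nat \<lfloor>card V / b\<rfloor>"
  proof -
    have "card T0 * b \<le> card V" using T0 unfolding P_def by linarith
    then have "card T0 \<le> card V / b" using b_pos by (simp add: pos_le_divide_eq)
    then show ?thesis by linarith
  qed
  ultimately show ?thesis using T0 by (auto simp: P_def)
qed

lemma sample_nonneighbours:
  assumes W: "sample m W" and x: "x \<in> V"
  shows "card {y \<in> W. \<not> E x y} \<le> m - (lo + c) / card V * m + c / (4 * card V) * m"
    and "card {y \<in> W. \<not> E y x} \<le> m - c / card V * m + c / (4 * card V) * m"
proof -
  have WV: "W \<subseteq> V" using W by (simp add: sample_def)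
  have comp: "real (card {y \<in> V. \<not> Q y}) = card V - real (card {y \<in> V. Q y})" for Q
  proof -
    have "{y \<in> V. \<not> Q y} = V - {y \<in> V. Q y}" by auto
    then show ?thesis using finite_V
      by (simp add: card_Diff_subset of_nat_diff card_mono)
  qed
  have scale: "z / card V * m \<le> m - t / card V * m" if "z \<le> card V - t" for z t :: real
  proof -
    have "z / card V * m \<le> (card V - t) / card V * m"
      using that by (intro mult_right_mono divide_right_mono) auto
    also have "\<dots> = m - t / card V * m" using card_V_pos by (simp add: diff_divide_distrib left_diff_distrib)
    finally show ?thesis .
  qed
  have "{y \<in> V. \<not> E x y} \<in> test_sets" using x by (auto simp: test_sets_def Let_def)
  then have "real (card ({y \<in> V. \<not> E x y} \<inter> W)) \<le> real (card {y \<in> V. \<not> E x y}) / card V * m + c / (4 * card V) * m"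
    using W by (simp add: sample_def)
  moreover have "{y \<in> V. \<not> E x y} \<inter> W = {y \<in> W. \<not> E x y}" using WV by auto
  ultimately show "card {y \<in> W. \<not> E x y} \<le> m - (lo + c) / card V * m + c / (4 * card V) * m"
    using scale[of "card {y \<in> V. \<not> E x y}" "lo + c"] outdeg[OF x] by (simp add: comp)
  have "{y \<in> V. \<not> E y x} \<in> test_sets" using x by (auto simp: test_sets_def Let_def)
  then have "real (card ({y \<in> V. \<not> E y x} \<inter> W)) \<le> real (card {y \<in> V. \<not> E y x}) / card V * m + c / (4 * card V) * m"
    using W by (simp add: sample_def)
  moreover have "{y \<in> V. \<not> E y x} \<inter> W = {y \<in> W. \<not> E y x}" using WV by auto
  ultimately show "card {y \<in> W. \<not> E y x} \<le> m - c / card V * m + c / (4 * card V) * m"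
    using scale[of "card {y \<in> V. \<not> E y x}" c] indeg[OF x] by (simp add: comp)
qed

text \<open>The surplus \<open>c / (2 * card V) * m\<close> is more than perfect matchings need; it
  is the rate at which reachable sets grow from level to level in an absorber. Since
  \<open>T\<close> is nonempty, so is \<open>few X\<close>, which excludes the degenerate
  alternative of \<open>robust\<close>.\<close>

lemma sample_expands:
  assumes P: "sample m P" and Q: "sample m Q"
    and ST: "S \<subseteq> P" "T \<subseteq> Q" "S \<noteq> {}" "T \<noteq> {}" "\<And>x y. x \<in> S \<Longrightarrow> y \<in> T \<Longrightarrow> \<not> E x y"
  shows "real (card S) + card T \<le> m - c / (2 * card V) * m"
proof -
  have PV: "P \<subseteq> V" "Q \<subseteq> V" using P Q by (auto simp: sample_def)
  then have fin: "finite P" "finite Q" using finite_V finite_subset by blast+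
  have "T \<subseteq> V" using ST PV by auto
  then obtain T0 where T0: "T0 \<subseteq> T" "card T0 \<le> nat \<lfloor>card V / b\<rfloor>" "T \<subseteq> few (nonadj T0)"
    using fingerprint_exists by blast
  define X where "X = nonadj T0"
  have "T0 \<subseteq> V" using T0 \<open>T \<subseteq> V\<close> by auto
  then have tests: "X \<in> test_sets" "few X \<in> test_sets"
    using T0 by (auto simp: test_sets_def Let_def X_def)
  have "S \<subseteq> X \<inter> P" using ST T0 PV by (auto simp: X_def nonadj_def)
  then have "card S \<le> card (X \<inter> P)" using fin by (intro card_mono) auto
  also have "real (card (X \<inter> P)) \<le> card X / card V * m + c / (4 * card V) * m"
    using P tests by (simp add: sample_def)
  finally have S: "card S \<le> card X / card V * m + c / (4 * card V) * m" by simp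
  have half: "c / (4 * card V) * m + c / (4 * card V) * m = c / (2 * card V) * m"
    "c / card V * m = 2 * (c / (2 * card V) * m)" by (simp_all add: field_simps)
  show ?thesis
  proof (cases "lo \<le> card X")
    case True
    have "T \<subseteq> few X \<inter> Q" using ST T0 by (auto simp: X_def)
    then have "card T \<le> card (few X \<inter> Q)" using fin by (intro card_mono) auto
    also have "real (card (few X \<inter> Q)) \<le> card (few X) / card V * m + c / (4 * card V) * m"
      using Q tests by (simp add: sample_def)
    finally have T: "card T \<le> card (few X) / card V * m + c / (4 * card V) * m" by simp
    have "few X \<noteq> {}" using T0 ST by (auto simp: X_def)
    moreover have "X \<subseteq> V" by (auto simp: X_def nonadj_def)
    ultimately have "real (card (few X)) + card X \<le> card V - c"
      using robust[of X] True unfolding few_def by auto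
    then have "(real (card (few X)) + card X) / card V * m \<le> (card V - c) / card V * m"
      by (intro mult_right_mono divide_right_mono) auto
    also have "\<dots> = m - c / card V * m" using card_V_pos by (simp add: diff_divide_distrib left_diff_distrib)
    finally have "card (few X) / card V * m + card X / card V * m \<le> m - c / card V * m"
      by (simp add: add_divide_distrib distrib_right)
    then show ?thesis using S T half by linarith
  next
    \<comment> \<open>Here \<open>X\<close> is too small for \<open>robust\<close>. But then
      \<open>S\<close> has density at most \<open>lo / card V\<close> up to the error, and a single
      vertex of \<open>S\<close> keeps its \<open>lo + c\<close> outneighbours out of
      \<open>T\<close>.\<close>
    case False
    obtain x where x: "x \<in> S" using ST by blast
    then have "x \<in> V" using ST PV by auto
    have "T \<subseteq> {y \<in> Q. \<not> E x y}" using x ST by auto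
    then have "card T \<le> card {y \<in> Q. \<not> E x y}" using fin by (intro card_mono) auto
    then have T: "card T \<le> m - (lo + c) / card V * m + c / (4 * card V) * m"
      using sample_nonneighbours(1)[OF Q \<open>x \<in> V\<close>] by linarith
    have "card X / card V * m \<le> lo / card V * m"
      using False by (intro mult_right_mono divide_right_mono) auto
    moreover have "(lo + c) / card V * m = lo / card V * m + c / card V * m"
      by (simp add: add_divide_distrib distrib_right)
    ultimately show ?thesis using S T half by linarith
  qed
qed

lemma sample_outneighbour:
  assumes "sample m W" "x \<in> V" "0 < m" "0 \<le> lo"
  shows "\<exists>y\<in>W. E x y"
proof (rule ccontr)
  assume "\<not> ?thesis"
  then have "{y \<in> W. \<not> E x y} = W" by auto
  then have "m \<le> m - (lo + c) / card V * m + c / (4 * card V) * m"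
    using sample_nonneighbours(1)[OF assms(1,2)] assms(1) by (simp add: sample_def)
  moreover have "c / (4 * card V) * m < (lo + c) / card V * m"
    using assms card_V_pos c_pos by (intro mult_strict_right_mono) (auto simp: field_simps)
  ultimately show False by linarith
qed

lemma sample_inneighbour:
  assumes "sample m W" "x \<in> V" "0 < m"
  shows "\<exists>y\<in>W. E y x"
proof (rule ccontr)
  assume "\<not> ?thesis"
  then have "{y \<in> W. \<not> E y x} = W" by auto
  then have "m \<le> m - c / card V * m + c / (4 * card V) * m"
    using sample_nonneighbours(2)[OF assms(1,2)] assms(1) by (simp add: sample_def)
  moreover have "c / (4 * card V) * m < c / card V * m"
    using assms card_V_pos c_pos by (intro mult_strict_right_mono) (auto simp: field_simps)
  ultimately show False by linarith
qed

lemma sample_perfect_matching: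
  assumes P: "sample m P" and Q: "sample m Q"
  shows "\<exists>f. bij_betw f P Q \<and> (\<forall>x\<in>P. E x (f x))"
proof -
  have PQ: "P \<subseteq> V" "Q \<subseteq> V" "card P = m" "card Q = m" using P Q by (auto simp: sample_def)
  then have fin: "finite P" "finite Q" using finite_V finite_subset by blast+
  have "\<exists>f. inj_on f P \<and> (\<forall>x\<in>P. f x \<in> {y \<in> Q. E x y})"
  proof (rule hall_marriage)
    fix S assume S: "S \<subseteq> P"
    let ?N = "\<Union>x\<in>S. {y \<in> Q. E x y}"
    show "card S \<le> card ?N"
    proof (cases "S = {} \<or> Q - ?N = {}")
      case True
      moreover have "card S \<le> m" using S PQ fin card_mono by blast
      moreover have "?N = Q" if "Q - ?N = {}" using that by auto
      ultimately show ?thesis using PQ by auto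
    next
      case False
      then have "real (card S) + card (Q - ?N) \<le> m - c / (2 * card V) * m"
        using S by (intro sample_expands[OF P Q]) auto
      moreover have "0 \<le> c / (2 * card V) * m" using c_pos by simp
      ultimately have "real (card S) + card (Q - ?N) \<le> m" by linarith
      moreover have "card (Q - ?N) = m - card ?N" "card ?N \<le> m"
        using fin PQ card_Diff_subset[of ?N Q] card_mono[of Q ?N] finite_subset[of ?N Q]
        by (metis (no_types, lifting) UN_least mem_Collect_eq subsetI)+
      ultimately show ?thesis by (simp add: of_nat_diff)
    qed
  qed (use fin in auto)
  then obtain f where f: "inj_on f P" "\<And>x. x \<in> P \<Longrightarrow> f x \<in> Q \<and> E x (f x)" by auto
  then have "f ` P = Q" using fin PQ by (intro card_subset_eq) (auto simp: card_image)
  then show ?thesis using f by (auto simp: bij_betw_def)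
qed

lemma card_test_sets_le:
  assumes "2 \<le> card V"
  shows "finite test_sets" "card test_sets \<le> 6 * card V ^ Suc (nat \<lfloor>card V / b\<rfloor>)"
proof -
  define q where "q = nat \<lfloor>card V / b\<rfloor>"
  define \<T> where "\<T> = {T. T \<subseteq> V \<and> card T \<le> q}"
  have T: "finite \<T>" "card \<T> \<le> card V ^ q + 1"
    unfolding \<T>_def using card_small_subsets_le[OF finite_V] by auto
  let ?A = "(\<lambda>x. {y \<in> V. \<not> E x y}) ` V" and ?B = "(\<lambda>y. {x \<in> V. \<not> E x y}) ` V"
  have eq: "test_sets = nonadj ` \<T> \<union> few ` nonadj ` \<T> \<union> ?A \<union> ?B"
    by (simp add: test_sets_def Let_def \<T>_def q_def)
  show "finite test_sets" unfolding eq using T finite_V by auto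
  have "card (nonadj ` \<T>) \<le> card \<T>" "card (few ` nonadj ` \<T>) \<le> card \<T>"
    using T card_image_le[of \<T> nonadj] card_image_le[of "nonadj ` \<T>" few] by auto
  moreover have "card ?A \<le> card V" "card ?B \<le> card V" using finite_V card_image_le by auto
  ultimately have "card test_sets \<le> card \<T> + card \<T> + card V + card V"
    unfolding eq by (meson add_mono card_Un_le order_trans)
  also have "\<dots> \<le> (card V ^ q + 1) + (card V ^ q + 1) + card V + card V"
    using T by (intro add_mono) auto
  finally have "card test_sets \<le> 2 * (card V ^ q + 1) + 2 * card V" by simp
  also have "\<dots> \<le> 6 * card V ^ Suc q"
  proof -
    have arith: "2 * (x + 1) + 2 * y \<le> 6 * z" if "x \<le> z" "y \<le> z" "1 \<le> z" for x y z :: nat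
      using that by simp
    have "card V ^ q \<le> card V ^ Suc q" "card V ^ 1 \<le> card V ^ Suc q"
      using assms by (auto intro!: power_increasing)
    then show ?thesis using assms by (intro arith) auto
  qed
  finally show "card test_sets \<le> 6 * card V ^ Suc (nat \<lfloor>card V / b\<rfloor>)" by (simp add: q_def)
qed

text \<open>The condition on \<open>m\<close> says
  \<open>\<delta>^2 * m / 4 > (card V / b + 3) * ln (card V)\<close> for
  \<open>\<delta> = c / (4 * card V)\<close>. The 3 collects the factors beyond the power
  \<open>card V / b\<close>: one in the bound on \<open>test_sets\<close>, one for its constant 6
  and one for the \<open>k\<close> samples.\<close>

lemma samples_exist:
  assumes km: "k * m \<le> card V" "0 < m" and n6: "6 \<le> card V"
    and m: "64 * (card V / c)\<^sup>2 * (card V / b + 3) * ln (card V) < m"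
  shows "\<exists>W. (\<forall>i<k. sample m (W i)) \<and> (\<forall>i<k. \<forall>j<k. i \<noteq> j \<longrightarrow> W i \<inter> W j = {})"
proof -
  define q where "q = nat \<lfloor>card V / b\<rfloor>"
  define \<delta> where "\<delta> = c / (4 * card V)"
  have \<delta>: "0 \<le> \<delta>" "\<delta> \<le> 1" using c_pos c_le_card card_V_pos by (auto simp: \<delta>_def field_simps)
  have tests: "finite test_sets" "card test_sets \<le> 6 * card V ^ Suc q"
    using card_test_sets_le n6 by (auto simp: q_def)
  have sub: "Z \<subseteq> V" if "Z \<in> test_sets" for Z
    using that by (auto simp: test_sets_def Let_def nonadj_def few_def)
  have "k * 1 \<le> k * m" using km by (intro mult_le_mono) auto
  then have "k \<le> card V" using km by linarith
  then have "k * card test_sets \<le> card V * (card V * card V ^ Suc q)"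
    using tests n6 by (intro mult_le_mono order.trans[OF tests(2)]) auto
  also have "\<dots> = card V ^ (q + 3)" by (simp add: numeral_3_eq_3)
  finally have "real (k * card test_sets) \<le> real (card V ^ (q + 3))" by (rule of_nat_mono)
  also have "\<dots> = exp (real (q + 3) * ln (card V))"
    using card_V_pos by (simp only: exp_of_nat_mult exp_ln of_nat_0_less_iff of_nat_power)
  also have "\<dots> < exp (\<delta>\<^sup>2 * m / 4)"
  proof -
    have "real q \<le> card V / b" using b_pos by (simp add: q_def)
    then have "(q + 3) * ln (card V) \<le> (card V / b + 3) * ln (card V)"
      using n6 by (intro mult_right_mono) auto
    also have "64 * (card V / c)\<^sup>2 * \<dots> < m" using m by (simp add: mult.assoc)
    then have "(card V / b + 3) * ln (card V) < \<delta>\<^sup>2 * m / 4"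
      using c_pos card_V_pos by (simp add: \<delta>_def field_simps power2_eq_square)
    finally show ?thesis by simp
  qed
  finally have "real (k * card test_sets) * exp (- (\<delta>\<^sup>2 * m / 4)) < exp (\<delta>\<^sup>2 * m / 4) * exp (- (\<delta>\<^sup>2 * m / 4))"
    by (intro mult_strict_right_mono) auto
  then have "real (k * card test_sets) * exp (- (\<delta>\<^sup>2 * m / 4)) < 1"
    by (simp flip: exp_add)
  from disjoint_samples_exist[OF finite_V card_V_pos km(1) tests(1) sub \<delta> this]
  show ?thesis unfolding sample_def \<delta>_def by blast
qed

end

section \<open>Connecting paths and absorbers\<close>

text \<open>Cut out the segment between two occurrences of a vertex. Only the interior becomes
  distinct: the ends may recur in it or coincide, and are separated later by keeping the interior
  out of a set that contains them.\<close>

lemma successively_shorten: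
  assumes "successively E (x # C @ [y])"
  shows "\<exists>C'. distinct C' \<and> set C' \<subseteq> set C \<and> length C' \<le> length C \<and> successively E (x # C' @ [y])"
  using assms
proof (induction C rule: length_induct)
  case (1 C)
  show ?case
  proof (cases "distinct C")
    case False
    then obtain as z bs cs where C: "C = as @ [z] @ bs @ [z] @ cs" using not_distinct_decomp by blast
    have "successively E (x # (as @ [z] @ cs) @ [y])"
      using 1(2) unfolding C by (auto simp: successively_append_iff successively_Cons hd_append)
    moreover have "length (as @ [z] @ cs) < length C" by (simp add: C)
    ultimately obtain C' where "distinct C'" "set C' \<subseteq> set (as @ [z] @ cs)"
      "length C' \<le> length (as @ [z] @ cs)" "successively E (x # C' @ [y])"
      using 1(1) by blast
    then show ?thesis by (intro exI[of _ C']) (auto simp: C)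
  qed (use 1(2) in blast)
qed

context robust_system
begin

text \<open>Breadth-first search: a vertex outside \<open>R (Suc i)\<close> has no inneighbour in
  \<open>R i\<close>, so it belongs to \<open>few (R i)\<close>, and \<open>robust\<close> makes the
  reached set grow by \<open>c\<close> in each round until it is all of \<open>V\<close>.\<close>

lemma connector_exists:
  assumes x: "lo \<le> card {z \<in> V. E x z}" and y: "\<exists>z\<in>V. E z y"
  shows "\<exists>C. set C \<subseteq> V \<and> distinct C \<and> length C \<le> nat \<lceil>card V / c\<rceil> + 2 \<and> successively E (x # C @ [y])"
proof -
  define R where "R = rec_nat {z \<in> V. E x z} (\<lambda>_ A. A \<union> {z \<in> V. \<exists>w\<in>A. E w z})"
  have R: "R 0 = {z \<in> V. E x z}" "\<And>i. R (Suc i) = R i \<union> {z \<in> V. \<exists>w\<in>R i. E w z}"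
    by (auto simp: R_def)
  have RV: "R i \<subseteq> V" for i by (induction i) (auto simp: R)
  have finR: "finite (R i)" for i using RV finite_V finite_subset by blast
  have walk: "\<exists>C. set C \<subseteq> V \<and> C \<noteq> [] \<and> length C \<le> Suc i \<and> successively E (x # C) \<and> last C = z"
    if "z \<in> R i" for i z
    using that
  proof (induction i arbitrary: z)
    case 0
    then show ?case by (intro exI[of _ "[z]"]) (auto simp: R)
  next
    case (Suc i)
    show ?case
    proof (cases "z \<in> R i")
      case True
      then show ?thesis using Suc.IH[of z] by force
    next
      case False
      then obtain w where w: "w \<in> R i" "E w z" "z \<in> V" using Suc.prems by (auto simp: R)
      then obtain C where C: "set C \<subseteq> V" "C \<noteq> []" "length C \<le> Suc i" "successively E (x # C)" "last C = w"
        using Suc.IH by blast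
      then have "successively E ((x # C) @ [z])" using w by (subst successively_append_iff) auto
      then show ?thesis using C w by (intro exI[of _ "C @ [z]"]) auto
    qed
  qed
  have "R i = V \<or> i * c \<le> card (R i)" for i
  proof (induction i)
    case (Suc i)
    show ?case
    proof (cases "R (Suc i) = V")
      case False
      then have "R i \<noteq> V" using R(2)[of i] RV by auto
      have "R 0 \<subseteq> R i" by (induction i) (auto simp: R(2))
      then have "card (R 0) \<le> card (R i)" using finR by (intro card_mono)
      then have lo: "lo \<le> card (R i)" using x by (simp add: R(1))
      have sub: "V - R (Suc i) \<subseteq> few (R i)"
      proof
        fix z assume z: "z \<in> V - R (Suc i)"
        have none: "{w \<in> R i. E w z} = {}" using z by (auto simp: R)
        have "real (card {w \<in> R i. E w z}) < b" unfolding none using b_pos by simp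
        then show "z \<in> few (R i)" using z by (simp add: few_def)
      qed
      have "V - R (Suc i) \<noteq> {}" using False RV by blast
      then have "real (card (few (R i))) + card (R i) \<le> card V - c"
        using robust[OF RV lo] sub unfolding few_def by blast
      moreover have "card (V - R (Suc i)) \<le> card (few (R i))"
        using sub finite_V by (intro card_mono) (auto simp: few_def)
      moreover have "card (V - R (Suc i)) = card V - card (R (Suc i))" "card (R (Suc i)) \<le> card V"
        using RV finR finite_V by (auto simp: card_Diff_subset card_mono)
      moreover have "i * c \<le> card (R i)" using Suc \<open>R i \<noteq> V\<close> by blast
      ultimately have "Suc i * c \<le> card (R (Suc i))" by (simp add: algebra_simps of_nat_diff)
      then show ?thesis by blast
    qed simp
  qed simp
  \<comment> \<open>The successor makes \<open>i * c\<close> strictly exceed \<open>card V\<close>.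
    A vertex of \<open>R i\<close> is the end of an interior with up to \<open>i + 1\<close>
    vertices, hence the \<open>+ 2\<close> in the bound.\<close>
  moreover define i where "i = Suc (nat \<lceil>card V / c\<rceil>)"
  moreover have "card V < i * c"
  proof -
    have "card V / c < i" unfolding i_def by linarith
    then show ?thesis using c_pos by (simp add: pos_divide_less_eq)
  qed
  moreover have "card (R i) \<le> card V" using RV finite_V by (simp add: card_mono)
  ultimately have "R i = V" by (meson leD le_less_trans of_nat_mono)
  then obtain z where z: "z \<in> R i" "E z y" using y by blast
  then obtain C where C: "set C \<subseteq> V" "C \<noteq> []" "length C \<le> Suc i" "successively E (x # C)" "last C = z"
    using walk by blast
  have "successively E ((x # C) @ [y])" using C z by (subst successively_append_iff) auto
  then obtain C' where "distinct C'" "set C' \<subseteq> set C" "length C' \<le> length C" "successively E (x # C' @ [y])"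
    using successively_shorten[of E x C y] by auto
  then show ?thesis using C by (intro exI[of _ C']) (auto simp: i_def)
qed

end

section \<open>Paths, absorbers and the exchange of arcs\<close>

definition dipath :: "('a \<Rightarrow> 'a \<Rightarrow> bool) \<Rightarrow> 'a list \<Rightarrow> bool" where
  "dipath E xs \<longleftrightarrow> xs \<noteq> [] \<and> distinct xs \<and> successively E xs"

lemma dipath_append_iff:
  assumes "xs \<noteq> []" "ys \<noteq> []"
  shows "dipath E (xs @ ys) \<longleftrightarrow> dipath E xs \<and> dipath E ys \<and> set xs \<inter> set ys = {} \<and> E (last xs) (hd ys)"
  using assms by (auto simp: dipath_def successively_append_iff)

text \<open>One \<open>Z\<close> has to serve every admissible family of paths. Keeping the first
  and the last vertex lets absorbers be concatenated and finally closed to a cycle.\<close>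

definition absorber :: "('a \<Rightarrow> 'a \<Rightarrow> bool) \<Rightarrow> 'a set \<Rightarrow> nat \<Rightarrow> 'a list \<Rightarrow> bool" where
  "absorber E V s Z \<longleftrightarrow> dipath E Z \<and>
     (\<forall>Qs. length Qs \<le> s \<and> (\<forall>Q\<in>set Qs. dipath E Q) \<and> distinct (concat Qs) \<and> set (concat Qs) \<subseteq> V - set Z \<longrightarrow>
       (\<exists>Z'. dipath E Z' \<and> hd Z' = hd Z \<and> last Z' = last Z \<and> set Z' = set Z \<union> set (concat Qs)))"

lemma absorberD:
  assumes "absorber E V s Z" "length Qs \<le> s" "\<And>Q. Q \<in> set Qs \<Longrightarrow> dipath E Q"
    "distinct (concat Qs)" "set (concat Qs) \<subseteq> V - set Z"
  shows "\<exists>Z'. dipath E Z' \<and> hd Z' = hd Z \<and> last Z' = last Z \<and> set Z' = set Z \<union> set (concat Qs)"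
  using assms unfolding absorber_def by blast

lemma absorber_append:
  assumes Y: "absorber E V s Y" and Z: "absorber E V t Z" and YZ: "dipath E (Y @ Z)"
  shows "absorber E V (s + t) (Y @ Z)"
proof -
  have ne: "Y \<noteq> []" "Z \<noteq> []" using Y Z by (auto simp: absorber_def dipath_def)
  have disj: "set Y \<inter> set Z = {}" "E (last Y) (hd Z)" using YZ ne by (auto simp: dipath_append_iff)
  have "\<exists>W. dipath E W \<and> hd W = hd (Y @ Z) \<and> last W = last (Y @ Z) \<and> set W = set (Y @ Z) \<union> set (concat Qs)"
    if Qs: "length Qs \<le> s + t" "\<forall>Q\<in>set Qs. dipath E Q" "distinct (concat Qs)" "set (concat Qs) \<subseteq> V - set (Y @ Z)" for Qs
  proof -
    have split: "concat Qs = concat (take s Qs) @ concat (drop s Qs)"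
      by (metis append_take_drop_id concat_append)
    have sub: "set (take s Qs) \<subseteq> set Qs" "set (drop s Qs) \<subseteq> set Qs"
      by (rule set_take_subset, rule set_drop_subset)
    have "distinct (concat (take s Qs))" "set (concat (take s Qs)) \<subseteq> V - set Y"
      using Qs(3,4) unfolding split by auto
    then obtain Y' where Y': "dipath E Y'" "hd Y' = hd Y" "last Y' = last Y" "set Y' = set Y \<union> set (concat (take s Qs))"
      using absorberD[OF Y, of "take s Qs"] sub(1) Qs(2) by (auto simp: subset_iff)
    have "distinct (concat (drop s Qs))" "set (concat (drop s Qs)) \<subseteq> V - set Z" "length (drop s Qs) \<le> t"
      using Qs(1,3,4) unfolding split by auto
    then obtain Z' where Z': "dipath E Z'" "hd Z' = hd Z" "last Z' = last Z" "set Z' = set Z \<union> set (concat (drop s Qs))"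
      using absorberD[OF Z, of "drop s Qs"] sub(2) Qs(2) by (auto simp: subset_iff)
    have ne': "Y' \<noteq> []" "Z' \<noteq> []" using Y' Z' by (auto simp: dipath_def)
    have "set Y' \<inter> set Z' = {}"
      using Qs(3,4) disj unfolding Y'(4) Z'(4) split by auto
    then have "dipath E (Y' @ Z')" using Y' Z' disj ne' by (simp add: dipath_append_iff)
    then show ?thesis using Y' Z' ne ne' by (intro exI[of _ "Y' @ Z'"]) (auto simp: split)
  qed
  then show ?thesis using YZ unfolding absorber_def by blast
qed

text \<open>Rerouting a path at one arc of each of its consecutive segments, the arc \<open>(a\<^sub>i, b\<^sub>i)\<close> of the
  \<open>i\<close>-th segment being replaced by \<open>(a\<^sub>i, b\<^sub>i\<^sub>+\<^sub>1)\<close>, leaves two paths; the parity of the number of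
  segments decides which of them ends in the open end \<open>a\<close>.\<close>
definition strands :: "('a \<Rightarrow> 'a \<Rightarrow> bool) \<Rightarrow> 'a list \<Rightarrow> 'a \<Rightarrow> bool \<Rightarrow> 'a \<Rightarrow> bool" where
  "strands E Z w p a \<longleftrightarrow> (\<exists>F G. dipath E F \<and> dipath E G \<and> set F \<inter> set G = {} \<and> set F \<union> set G = set Z \<and>
     hd F = hd Z \<and> E w (hd G) \<and>
     (if p then last F = a \<and> last G = last Z else last F = last Z \<and> last G = a))"

lemma strands_start:
  assumes "dipath E Z" "Z = X @ a # b # Y" "E w b"
  shows "strands E Z w True a"
proof -
  have "Z = (X @ [a]) @ (b # Y)" using assms by simp
  then show ?thesis unfolding strands_def using assms
    by (intro exI[of _ "X @ [a]"] exI[of _ "b # Y"])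
      (auto simp: dipath_def successively_append_iff hd_append successively_Cons)
qed

text \<open>Cut \<open>Z'\<close> at the arc into \<open>B\<close>, ending in \<open>a'\<close>, and
  \<open>C\<close>, starting with \<open>b'\<close>. The strand with open end \<open>a\<close>
  continues through \<open>b'\<close> along \<open>C\<close> to the end of \<open>Z'\<close>; the
  other one continues along \<open>B\<close> and becomes the open one. The roles are exchanged,
  hence \<open>\<not> p\<close>.\<close>

lemma strands_step:
  assumes Z: "strands E Z w p a" and ZZ': "dipath E (Z @ Z')" "Z \<noteq> []"
    and Z': "Z' = X @ a' # b' # Y" and E: "E a b'"
  shows "strands E (Z @ Z') w (\<not> p) a'"
proof -
  obtain F G where FG: "dipath E F" "dipath E G" "set F \<inter> set G = {}" "set F \<union> set G = set Z"
     "hd F = hd Z" "E w (hd G)" "if p then last F = a \<and> last G = last Z else last F = last Z \<and> last G = a"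
    using Z by (auto simp: strands_def)
  define B where "B = X @ [a']"
  define C where "C = b' # Y"
  have BC: "Z' = B @ C" "B \<noteq> []" "C \<noteq> []" "last B = a'" "hd C = b'" "last C = last Z'" "hd B = hd Z'"
    by (auto simp: B_def C_def Z' hd_append)
  have "Z' \<noteq> []" using Z' by simp
  then have Zs: "dipath E Z'" "set Z \<inter> set Z' = {}" "E (last Z) (hd Z')"
    using ZZ' by (auto simp: dipath_append_iff)
  then have BCp: "dipath E B" "dipath E C" "set B \<inter> set C = {}" using BC(1-3) by (auto simp: dipath_append_iff)
  have ne: "F \<noteq> []" "G \<noteq> []" using FG by (auto simp: dipath_def)
  have disj: "set F \<inter> set B = {}" "set F \<inter> set C = {}" "set G \<inter> set B = {}" "set G \<inter> set C = {}"
    using FG(4) Zs(2) BC(1) by auto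
  have heads: "hd (F @ B) = hd (Z @ Z')" "hd (F @ C) = hd (Z @ Z')" "hd (G @ B) = hd G" "hd (G @ C) = hd G"
    and lasts: "last (F @ B) = a'" "last (F @ C) = last (Z @ Z')" "last (G @ B) = a'" "last (G @ C) = last (Z @ Z')"
    using BC(2-7) ne FG(5) ZZ'(2) \<open>Z' \<noteq> []\<close> by (simp_all add: hd_append)
  have sets: "set (F @ C) \<inter> set (G @ B) = {}" "set (F @ B) \<inter> set (G @ C) = {}"
    "set (F @ C) \<union> set (G @ B) = set (Z @ Z')" "set (F @ B) \<union> set (G @ C) = set (Z @ Z')"
    using FG(3,4) BC(1) BCp(3) disj by auto
  show ?thesis
  proof (cases p)
    case True
    then have ends: "last F = a" "last G = last Z" using FG(7) by auto
    have "dipath E (F @ C)" "dipath E (G @ B)"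
      unfolding dipath_append_iff[OF ne(1) BC(3)] dipath_append_iff[OF ne(2) BC(2)] ends BC(5,7)
      using FG(1,2) BCp Zs(3) disj E by auto
    then show ?thesis unfolding strands_def
      using True FG(6) heads lasts sets by (intro exI[of _ "F @ C"] exI[of _ "G @ B"] conjI) simp_all
  next
    case False
    then have ends: "last F = last Z" "last G = a" using FG(7) by auto
    have "dipath E (F @ B)" "dipath E (G @ C)"
      unfolding dipath_append_iff[OF ne(1) BC(2)] dipath_append_iff[OF ne(2) BC(3)] ends BC(5,7)
      using FG(1,2) BCp Zs(3) disj E by auto
    then show ?thesis unfolding strands_def
      using False FG(6) heads lasts sets by (intro exI[of _ "F @ B"] exI[of _ "G @ C"] conjI) simp_all
  qed
qed

text \<open>With flag \<open>True\<close> the strand from \<open>hd Z\<close> is the open one, and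
  \<open>F @ Q @ G\<close> is a path with the old ends. With flag \<open>False\<close> the insertion
  of \<open>Q\<close> would close \<open>G\<close> to a separate cycle; this is why the number of
  levels must be odd.\<close>

lemma strands_absorb:
  assumes "strands E Z w True a" "dipath E Q" "last Q = w" "E a (hd Q)" "set Q \<inter> set Z = {}"
  shows "\<exists>Z'. dipath E Z' \<and> hd Z' = hd Z \<and> last Z' = last Z \<and> set Z' = set Z \<union> set Q"
proof -
  obtain F G where FG: "dipath E F" "dipath E G" "set F \<inter> set G = {}" "set F \<union> set G = set Z"
     "hd F = hd Z" "E w (hd G)" "last F = a" "last G = last Z"
    using assms(1) by (auto simp: strands_def)
  have ne: "F \<noteq> []" "G \<noteq> []" "Q \<noteq> []" using FG assms by (auto simp: dipath_def)
  have "dipath E (Q @ G)" using FG assms ne by (auto simp: dipath_append_iff)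
  then have "dipath E (F @ Q @ G)" using FG assms ne by (subst dipath_append_iff) auto
  then show ?thesis using FG ne by (intro exI[of _ "F @ Q @ G"]) auto
qed

definition level_path :: "('a \<Rightarrow> 'a \<Rightarrow> bool) \<Rightarrow> 'a list \<Rightarrow> ('a \<times> 'a) list \<Rightarrow> bool" where
  "level_path E Z l \<longleftrightarrow> dipath E Z \<and> (\<forall>(a, b)\<in>set l. \<exists>X Y. Z = X @ a # b # Y)"

text \<open>One round of growth of the possible open ends: from the tail \<open>fst e\<close> of an
  arc in \<open>S\<close> the head \<open>snd e'\<close> is entered, which frees the tail of
  \<open>e'\<close> as the next open end.\<close>

definition expanding :: "('a \<Rightarrow> 'a \<Rightarrow> bool) \<Rightarrow> real \<Rightarrow> ('a \<times> 'a) list \<Rightarrow> ('a \<times> 'a) list \<Rightarrow> bool" where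
  "expanding E g l l' \<longleftrightarrow> (\<forall>S\<subseteq>set l. S \<noteq> {} \<longrightarrow> (let S' = {e' \<in> set l'. \<exists>e\<in>S. E (fst e) (snd e')} in
     S' = set l' \<or> real (card S) + g \<le> real (card S')))"

text \<open>\<open>A\<close> collects arcs of the last level whose tails can serve as open ends. The
  first level guarantees only one such arc, through an outneighbour of \<open>w\<close>; every
  further level adds \<open>g\<close> until a level is full, hence the factor
  \<open>length L - 1\<close>.\<close>

lemma level_strands:
  fixes g :: real
  assumes "L \<noteq> []" "list_all2 (level_path E) Zs L" "dipath E (concat Zs)" "0 < g"
    and "\<And>l. l \<in> set L \<Longrightarrow> card (set l) = m" "0 < m"
    and "\<And>l l'. l \<in> set L \<Longrightarrow> l' \<in> set L \<Longrightarrow> expanding E g l l'"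
    and "\<And>l. l \<in> set L \<Longrightarrow> \<exists>e\<in>set l. E w (snd e)"
  shows "\<exists>A. A \<subseteq> set (last L) \<and> A \<noteq> {} \<and> (A = set (last L) \<or> real (length L - 1) * g \<le> card A) \<and>
    (\<forall>e\<in>A. strands E (concat Zs) w (odd (length L)) (fst e))"
  using assms
proof (induction L arbitrary: Zs rule: rev_nonempty_induct)
  case (single l)
  then obtain Z where Z: "Zs = [Z]" "level_path E Z l" by (auto simp: list_all2_Cons2)
  define A where "A = {e \<in> set l. E w (snd e)}"
  have "strands E Z w True (fst e)" if e: "e \<in> A" for e
  proof -
    obtain X Y where "Z = X @ fst e # snd e # Y"
      using Z e unfolding level_path_def A_def by fastforce
    then show ?thesis using strands_start Z e unfolding level_path_def A_def by fastforce
  qed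
  then show ?case using single.prems Z by (intro exI[of _ A]) (fastforce simp: A_def)
next
  case (snoc l L)
  then obtain Ys Z where Z: "Zs = Ys @ [Z]" "list_all2 (level_path E) Ys L" "level_path E Z l"
    by (auto simp: list_all2_append2 list_all2_Cons2)
  have Ys: "concat Ys \<noteq> []"
  proof -
    obtain l0 L0 where "L = l0 # L0" using snoc.hyps by (cases L) auto
    then obtain Z0 Y0 where "Ys = Z0 # Y0" "level_path E Z0 l0" using Z(2) by (auto simp: list_all2_Cons2)
    then show ?thesis by (auto simp: level_path_def dipath_def)
  qed
  have Zne: "Z \<noteq> []" using Z by (auto simp: level_path_def dipath_def)
  have YZ: "dipath E (concat Ys @ Z)" using snoc.prems Z by simp
  then have "dipath E (concat Ys)" using Ys Zne by (simp add: dipath_append_iff)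
  then have "\<exists>A. A \<subseteq> set (last L) \<and> A \<noteq> {} \<and> (A = set (last L) \<or> real (length L - 1) * g \<le> card A) \<and>
      (\<forall>e\<in>A. strands E (concat Ys) w (odd (length L)) (fst e))"
    by (rule snoc.IH[OF Z(2) _ snoc.prems(3) _ snoc.prems(5)])
      (use snoc.prems(4,6,7) in auto)
  then obtain A where A: "A \<subseteq> set (last L)" "A \<noteq> {}" "A = set (last L) \<or> real (length L - 1) * g \<le> card A"
    "\<And>e. e \<in> A \<Longrightarrow> strands E (concat Ys) w (odd (length L)) (fst e)"
    by blast
  define A' where "A' = {e' \<in> set l. \<exists>e\<in>A. E (fst e) (snd e')}"
  have lL: "last L \<in> set L" using snoc.hyps by simp
  then have "expanding E g (last L) l" using snoc.prems by auto
  then have A'card: "A' = set l \<or> card A + g \<le> card A'"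
    using A(1,2) unfolding expanding_def A'_def Let_def by blast
  have le: "card A' \<le> m" "card (set l) = m" "card (set (last L)) = m"
    using snoc.prems lL card_mono[of "set l" A'] by (auto simp: A'_def)
  have finA: "finite A" using A finite_subset by blast
  then have "0 < card A" using A by (simp add: card_gt_0_iff)
  have "A' \<noteq> {}" using A'card \<open>0 < g\<close> le \<open>0 < m\<close> by auto
  moreover have "A' = set l \<or> real (length (L @ [l]) - 1) * g \<le> card A'"
  proof (cases "A' = set l")
    case False
    then have gr: "card A + g \<le> card A'" using A'card by blast
    then have "real (card A) < real m" using le \<open>0 < g\<close> by linarith
    then have "A \<noteq> set (last L)" using le by auto
    then have "real (length L - 1) * g \<le> card A" using A by blast
    moreover have len: "real (length (L @ [l]) - 1) = real (length L - 1) + 1"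
      using snoc.hyps by (cases L) auto
    have "real (length (L @ [l]) - 1) * g = real (length L - 1) * g + g"
      unfolding len by (simp only: distrib_right mult_1)
    ultimately have "real (length (L @ [l]) - 1) * g \<le> card A'" using gr by linarith
    then show ?thesis by (rule disjI2)
  qed simp
  moreover have "strands E (concat Zs) w (odd (length (L @ [l]))) (fst e')" if e': "e' \<in> A'" for e'
  proof -
    obtain e where e: "e \<in> A" "E (fst e) (snd e')" using e' by (auto simp: A'_def)
    obtain X Y where "Z = X @ fst e' # snd e' # Y"
      using Z e' unfolding level_path_def A'_def by fastforce
    then have "strands E (concat Ys @ Z) w (\<not> odd (length L)) (fst e')"
      using strands_step[OF A(4)[OF e(1)] YZ Ys] e(2) by blast
    then show ?thesis using Z by simp
  qed
  ultimately show ?case by (intro exI[of _ A']) (auto simp: A'_def)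
qed

lemma levels_absorb_one:
  fixes g :: real
  assumes L: "odd (length L)" "m < real (length L - 1) * g"
    and Zs: "list_all2 (level_path E) Zs L" "dipath E (concat Zs)" "0 < g"
    and m: "\<And>l. l \<in> set L \<Longrightarrow> card (set l) = m" "0 < m"
    and exp: "\<And>l l'. l \<in> set L \<Longrightarrow> l' \<in> set L \<Longrightarrow> expanding E g l l'"
    and out: "\<And>l w. l \<in> set L \<Longrightarrow> w \<in> V \<Longrightarrow> \<exists>e\<in>set l. E w (snd e)"
    and inn: "\<And>l u. l \<in> set L \<Longrightarrow> u \<in> V \<Longrightarrow> \<exists>e\<in>set l. E (fst e) u"
  shows "absorber E V 1 (concat Zs)"
proof -
  have Lne: "L \<noteq> []" using L by auto
  have one: "\<exists>Z'. dipath E Z' \<and> hd Z' = hd (concat Zs) \<and> last Z' = last (concat Zs) \<and> set Z' = set (concat Zs) \<union> set Q"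
    if Q: "dipath E Q" "set Q \<subseteq> V - set (concat Zs)" for Q
  proof -
    have QV: "last Q \<in> V" "hd Q \<in> V"
      using Q last_in_set[of Q] hd_in_set[of Q] unfolding dipath_def by blast+
    obtain A where A: "A \<subseteq> set (last L)" "A = set (last L) \<or> real (length L - 1) * g \<le> card A"
      "\<And>e. e \<in> A \<Longrightarrow> strands E (concat Zs) (last Q) True (fst e)"
      using level_strands[OF Lne Zs m exp out[OF _ QV(1)]] L(1) by auto
    have "card A \<le> m" using A(1) m Lne card_mono[of "set (last L)" A] by auto
    \<comment> \<open>The growth bound would exceed the size \<open>m\<close> of the level. So every
      arc of the last level is available, in particular one whose tail is an inneighbour of
      \<open>hd Q\<close>.\<close>
    then have "A = set (last L)" using A(2) L(2) by linarith
    then obtain e where "e \<in> A" "E (fst e) (hd Q)" using inn[of "last L" "hd Q"] QV Lne by auto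
    then show ?thesis using strands_absorb[OF A(3) Q(1)] Q(2) by blast
  qed
  show ?thesis unfolding absorber_def
  proof (intro conjI allI impI)
    fix Qs assume Qs: "length Qs \<le> 1 \<and> (\<forall>Q\<in>set Qs. dipath E Q) \<and> distinct (concat Qs) \<and> set (concat Qs) \<subseteq> V - set (concat Zs)"
    show "\<exists>Z'. dipath E Z' \<and> hd Z' = hd (concat Zs) \<and> last Z' = last (concat Zs) \<and> set Z' = set (concat Zs) \<union> set (concat Qs)"
    proof (cases Qs)
      case Nil
      then show ?thesis using Zs(2) by (intro exI[of _ "concat Zs"]) auto
    next
      case (Cons Q Qs')
      then show ?thesis using Qs one[of Q] by auto
    qed
  qed (rule Zs)
qed

text \<open>The levels are divided into \<open>Suc s\<close> consecutive blocks of \<open>t\<close>,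
  each of which absorbs one path.\<close>

lemma levels_absorb:
  fixes g :: real
  assumes "length L = Suc s * t" "odd t" "m < real (t - 1) * g"
    and "list_all2 (level_path E) Zs L" "dipath E (concat Zs)" "0 < g"
    and "\<And>l. l \<in> set L \<Longrightarrow> card (set l) = m" "0 < m"
    and "\<And>l l'. l \<in> set L \<Longrightarrow> l' \<in> set L \<Longrightarrow> expanding E g l l'"
    and "\<And>l w. l \<in> set L \<Longrightarrow> w \<in> V \<Longrightarrow> \<exists>e\<in>set l. E w (snd e)"
    and "\<And>l u. l \<in> set L \<Longrightarrow> u \<in> V \<Longrightarrow> \<exists>e\<in>set l. E (fst e) u"
  shows "absorber E V (Suc s) (concat Zs)"
  using assms
proof (induction s arbitrary: L Zs)
  case 0
  have len: "length L = t" using 0(1) by simp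
  have "absorber E V 1 (concat Zs)"
  proof (rule levels_absorb_one[OF _ _ 0(4-11)])
    show "real m < real (length L - 1) * g" using 0(3) unfolding len .
  qed (use 0(2) len in simp_all)
  then show ?case by simp
next
  case (Suc s)
  define Z1 where "Z1 = take t Zs"
  define Z2 where "Z2 = drop t Zs"
  define L1 where "L1 = take t L"
  define L2 where "L2 = drop t L"
  have la: "list_all2 (level_path E) Z1 L1" "list_all2 (level_path E) Z2 L2"
    using Suc.prems(4) unfolding Z1_def Z2_def L1_def L2_def
    by (auto intro: list_all2_takeI list_all2_dropI)
  have len: "length L1 = t" "length L2 = Suc s * t" using Suc.prems(1) by (auto simp: L1_def L2_def)
  have sub: "set L1 \<subseteq> set L" "set L2 \<subseteq> set L"
    unfolding L1_def L2_def by (rule set_take_subset, rule set_drop_subset)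
  have ne: "concat Zs' \<noteq> []" if L': "list_all2 (level_path E) Zs' L'" "L' \<noteq> []" for Zs' L'
  proof -
    obtain l0 L0 where "L' = l0 # L0" using L'(2) by (cases L') auto
    then obtain Z0 Y0 where "Zs' = Z0 # Y0" "level_path E Z0 l0" using L'(1) by (auto simp: list_all2_Cons2)
    then show ?thesis by (auto simp: level_path_def dipath_def)
  qed
  have "0 < t" using Suc.prems(2) by (rule odd_pos)
  then have "L1 \<noteq> []" "L2 \<noteq> []" using len by auto
  then have ne12: "concat Z1 \<noteq> []" "concat Z2 \<noteq> []" using ne la by blast+
  have cc: "concat Zs = concat Z1 @ concat Z2"
    unfolding Z1_def Z2_def by (metis append_take_drop_id concat_append)
  have dp: "dipath E (concat Z1 @ concat Z2)" using Suc.prems(5) cc by simp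
  then have dps: "dipath E (concat Z1)" "dipath E (concat Z2)" using ne12 by (auto simp: dipath_append_iff)
  have "absorber E V 1 (concat Z1)"
  proof (rule levels_absorb_one[OF _ _ la(1) dps(1) Suc.prems(6) _ Suc.prems(8)])
    show "real m < real (length L1 - 1) * g" using Suc.prems(3) unfolding len .
  qed (use Suc.prems(2,7,9-11) len sub in \<open>auto simp: subset_iff\<close>)
  moreover have "absorber E V (Suc s) (concat Z2)"
    by (rule Suc.IH[OF len(2) Suc.prems(2,3) la(2) dps(2) Suc.prems(6) _ Suc.prems(8)])
      (use Suc.prems(7,9-11) sub in \<open>auto simp: subset_iff\<close>)
  ultimately show ?case using absorber_append[OF _ _ dp] cc by fastforce
qed

section \<open>Path covers\<close>

definition endpoints :: "('a \<times> 'a) list \<Rightarrow> 'a list" where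
  "endpoints es = concat (map (\<lambda>e. [fst e, snd e]) es)"

lemma endpoints_simps [simp]:
  "endpoints [] = []" "endpoints (e # es) = fst e # snd e # endpoints es"
  by (simp_all add: endpoints_def)

lemma set_endpoints: "set (endpoints es) = fst ` set es \<union> snd ` set es"
  by (induction es) auto

text \<open>Built from the back: each arc is put in front and joined to the current first vertex by
  a connector. \<open>U\<close> holds the ends of all prescribed arcs, including those still to
  come, so that no connector runs into them. The target \<open>y\<close> is left open because it may
  be the first vertex of the whole path, which then closes to a cycle.\<close>

lemma level_path_exists:
  assumes conn: "\<And>U x y. U \<subseteq> V \<Longrightarrow> card U \<le> B \<Longrightarrow> x \<in> V \<Longrightarrow> y \<in> V \<Longrightarrow>
      \<exists>C. set C \<subseteq> V - U \<and> distinct C \<and> length C \<le> K \<and> successively E (x # C @ [y])"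
    and U: "U \<subseteq> V" "card U + K * length es \<le> B" and y: "y \<in> V"
    and es: "\<And>e. e \<in> set es \<Longrightarrow> E (fst e) (snd e)" "distinct (endpoints es)" "set (endpoints es) \<subseteq> U"
  shows "\<exists>Z. distinct Z \<and> successively E (Z @ [y]) \<and> hd (Z @ [y]) = hd (endpoints es @ [y]) \<and>
    (\<forall>(a, b)\<in>set es. \<exists>X Y. Z = X @ a # b # Y) \<and> set Z \<inter> U = set (endpoints es) \<and> set Z \<subseteq> V \<and>
    card (U \<union> set Z) \<le> card U + K * length es"
  using U(2) es
proof (induction es)
  case Nil
  then show ?case by (intro exI[of _ "[]"]) auto
next
  case (Cons e es)
  obtain a b where e: "e = (a, b)" by (cases e)
  have "\<exists>Z. distinct Z \<and> successively E (Z @ [y]) \<and> hd (Z @ [y]) = hd (endpoints es @ [y]) \<and>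
    (\<forall>(a, b)\<in>set es. \<exists>X Y. Z = X @ a # b # Y) \<and> set Z \<inter> U = set (endpoints es) \<and> set Z \<subseteq> V \<and>
    card (U \<union> set Z) \<le> card U + K * length es"
    using Cons.prems by (intro Cons.IH) auto
  then obtain Z where Z: "distinct Z" "successively E (Z @ [y])" "hd (Z @ [y]) = hd (endpoints es @ [y])"
    "\<forall>(a, b)\<in>set es. \<exists>X Y. Z = X @ a # b # Y" "set Z \<inter> U = set (endpoints es)" "set Z \<subseteq> V"
    "card (U \<union> set Z) \<le> card U + K * length es"
    by (elim exE conjE) (rule that, assumption+)
  have ab: "a \<in> U" "b \<in> U" "a \<noteq> b" "a \<notin> set Z" "b \<notin> set Z" "E a b"
  proof -
    have dist: "a \<noteq> b" "a \<notin> set (endpoints es)" "b \<notin> set (endpoints es)"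
      using Cons.prems(3) by (auto simp: e)
    show "a \<in> U" "b \<in> U" using Cons.prems(4) by (auto simp: e)
    then show "a \<notin> set Z" "b \<notin> set Z" "a \<noteq> b" using dist Z(5) by blast+
    show "E a b" using Cons.prems(2)[of e] by (simp add: e)
  qed
  have "hd (Z @ [y]) \<in> V" using Z(6) y by (cases Z) auto
  moreover have "card (U \<union> set Z) \<le> B" using Z(7) Cons.prems(1) by simp
  ultimately obtain C where C: "set C \<subseteq> V - (U \<union> set Z)" "distinct C" "length C \<le> K"
    "successively E (b # C @ [hd (Z @ [y])])"
    using conn[of "U \<union> set Z" b "hd (Z @ [y])"] U(1) Z(6) ab(2) by blast
  define Z' where "Z' = a # b # C @ Z"
  have "successively E (b # C @ (Z @ [y]))"
    using C(4) Z(2) by (cases "Z @ [y]") (auto simp: successively_Cons successively_append_iff hd_append)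
  then have "successively E (Z' @ [y])" using ab(6) by (simp add: Z'_def)
  moreover have "distinct Z'" using ab C Z(1) unfolding Z'_def by auto
  moreover have "\<exists>X Y. Z' = X @ a' # b' # Y" if ab': "(a', b') \<in> set (e # es)" for a' b'
  proof (cases "(a', b') = e")
    case True
    then show ?thesis using e by (intro exI[of _ "[]"] exI[of _ "C @ Z"]) (simp add: Z'_def)
  next
    case False
    then obtain X Y where "Z = X @ a' # b' # Y" using ab' Z(4) by auto
    then show ?thesis by (intro exI[of _ "a # b # C @ X"] exI[of _ Y]) (simp add: Z'_def)
  qed
  moreover have "set Z' \<inter> U = set (endpoints (e # es))"
    using ab C(1) Z(5) e unfolding Z'_def by auto
  moreover have "set Z' \<subseteq> V" using ab C(1) Z(6) U(1) unfolding Z'_def by auto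
  moreover have "card (U \<union> set Z') \<le> card U + K * length (e # es)"
  proof -
    have "U \<union> set Z' = (U \<union> set Z) \<union> set C" using ab unfolding Z'_def by auto
    then have "card (U \<union> set Z') \<le> card (U \<union> set Z) + card (set C)" by (simp only: card_Un_le)
    also have "card (set C) \<le> K" using C(3) card_length le_trans by blast
    finally show ?thesis using Z(7) by simp
  qed
  moreover have "hd (Z' @ [y]) = hd (endpoints (e # es) @ [y])" by (simp add: Z'_def e)
  ultimately show ?case by (intro exI[of _ Z']) blast
qed

text \<open>The levels are again threaded from the last to the first, each aiming at the first
  vertex of what follows, and vertices used so far are added to the avoided set.\<close>

lemma level_paths_exist:
  assumes conn: "\<And>U x y. U \<subseteq> V \<Longrightarrow> card U \<le> B \<Longrightarrow> x \<in> V \<Longrightarrow> y \<in> V \<Longrightarrow>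
      \<exists>C. set C \<subseteq> V - U \<and> distinct C \<and> length C \<le> K \<and> successively E (x # C @ [y])"
    and U: "U \<subseteq> V" "card U + K * length (concat L) \<le> B" and y: "y \<in> V"
    and L: "\<And>e. e \<in> set (concat L) \<Longrightarrow> E (fst e) (snd e)" "distinct (concat (map endpoints L))"
      "set (concat (map endpoints L)) \<subseteq> U" "[] \<notin> set L"
  shows "\<exists>Zs. list_all2 (level_path E) Zs L \<and> distinct (concat Zs) \<and> successively E (concat Zs @ [y]) \<and>
    hd (concat Zs @ [y]) = hd (concat (map endpoints L) @ [y]) \<and>
    set (concat Zs) \<inter> U = set (concat (map endpoints L)) \<and> set (concat Zs) \<subseteq> V \<and>
    card (U \<union> set (concat Zs)) \<le> card U + K * length (concat L)"
  using U(2) L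
proof (induction L)
  case Nil
  then show ?case by (intro exI[of _ "[]"]) auto
next
  case (Cons l L)
  have "\<exists>Zs. list_all2 (level_path E) Zs L \<and> distinct (concat Zs) \<and> successively E (concat Zs @ [y]) \<and>
    hd (concat Zs @ [y]) = hd (concat (map endpoints L) @ [y]) \<and>
    set (concat Zs) \<inter> U = set (concat (map endpoints L)) \<and> set (concat Zs) \<subseteq> V \<and>
    card (U \<union> set (concat Zs)) \<le> card U + K * length (concat L)"
    using Cons.prems by (intro Cons.IH) (auto simp: algebra_simps)
  then obtain Zs where Zs: "list_all2 (level_path E) Zs L" "distinct (concat Zs)" "successively E (concat Zs @ [y])"
    "hd (concat Zs @ [y]) = hd (concat (map endpoints L) @ [y])"
    "set (concat Zs) \<inter> U = set (concat (map endpoints L))" "set (concat Zs) \<subseteq> V"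
    "card (U \<union> set (concat Zs)) \<le> card U + K * length (concat L)"
    by blast
  define y' where "y' = hd (concat Zs @ [y])"
  have "set (concat Zs @ [y]) \<subseteq> V" using Zs(6) y by auto
  then have y': "y' \<in> V" unfolding y'_def using hd_in_set[of "concat Zs @ [y]"] by blast
  have "\<exists>Z. distinct Z \<and> successively E (Z @ [y']) \<and> hd (Z @ [y']) = hd (endpoints l @ [y']) \<and>
    (\<forall>(a, b)\<in>set l. \<exists>X Y. Z = X @ a # b # Y) \<and> set Z \<inter> (U \<union> set (concat Zs)) = set (endpoints l) \<and> set Z \<subseteq> V \<and>
    card ((U \<union> set (concat Zs)) \<union> set Z) \<le> card (U \<union> set (concat Zs)) + K * length l"
  proof (rule level_path_exists[OF conn _ _ y'])
    show "card (U \<union> set (concat Zs)) + K * length l \<le> B"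
      using Cons.prems(1) Zs(7) by (simp add: algebra_simps)
  qed (use Zs(6) U(1) Cons.prems in auto)
  then obtain Z where Z: "distinct Z" "successively E (Z @ [y'])" "hd (Z @ [y']) = hd (endpoints l @ [y'])"
    "\<forall>(a, b)\<in>set l. \<exists>X Y. Z = X @ a # b # Y" "set Z \<inter> (U \<union> set (concat Zs)) = set (endpoints l)" "set Z \<subseteq> V"
    "card ((U \<union> set (concat Zs)) \<union> set Z) \<le> card (U \<union> set (concat Zs)) + K * length l"
    by blast
  obtain e l' where l: "l = e # l'" using Cons.prems(5) by (cases l) auto
  then have Zne: "Z \<noteq> []" using Z(5) by auto
  have "set (endpoints l) \<inter> set (concat Zs) = {}"
  proof -
    have "set (endpoints l) \<inter> set (concat (map endpoints L)) = {}" "set (endpoints l) \<subseteq> U"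
      using Cons.prems(3,4) by auto
    then show ?thesis using Zs(5) by blast
  qed
  then have disj: "set Z \<inter> set (concat Zs) = {}" using Z(5) by auto
  have "successively E (Z @ (concat Zs @ [y]))"
    using Z(2) Zs(3) Zne unfolding y'_def by (auto simp: successively_append_iff)
  moreover have "level_path E Z l"
    using Z(1,2,4) Zne unfolding level_path_def dipath_def by (simp add: successively_append_iff)
  moreover have "hd (concat (Z # Zs) @ [y]) = hd (concat (map endpoints (l # L)) @ [y])"
    using Z(3) Zne l by (simp add: hd_append)
  moreover have "set (concat (Z # Zs)) \<inter> U = set (concat (map endpoints (l # L)))"
  proof -
    have "set (endpoints l) \<subseteq> U" using Cons.prems(4) by auto
    then have "set Z \<inter> U = set (endpoints l)" using Z(5) disj by blast
    then show ?thesis using Zs(5) by (simp add: Int_Un_distrib2)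
  qed
  moreover have "card (U \<union> set (concat (Z # Zs))) \<le> card U + K * length (concat (l # L))"
    using Z(7) Zs(7) by (simp add: algebra_simps Un_ac)
  ultimately show ?case
    using Z(1,6) Zs(1,2,6) disj by (intro exI[of _ "Z # Zs"]) (simp add: Int_commute)
qed

text \<open>Every path is prolonged along the matching into the next layer. The last two conclusions
  serve the induction: the ends are distinct and fill the layer, so the new ends are distinct and
  fill the next one.\<close>

lemma layers_path_cover:
  assumes "\<And>i. i < k \<Longrightarrow> \<exists>f. bij_betw f (W i) (W (Suc i)) \<and> (\<forall>x\<in>W i. E x (f x))"
    and "\<And>i j. i \<le> k \<Longrightarrow> j \<le> k \<Longrightarrow> i \<noteq> j \<Longrightarrow> W i \<inter> W j = {}" and "finite (W 0)"
  shows "\<exists>Qs. length Qs = card (W 0) \<and> (\<forall>Q\<in>set Qs. dipath E Q) \<and> distinct (concat Qs) \<and>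
    set (concat Qs) = (\<Union>i\<le>k. W i) \<and> distinct (map last Qs) \<and> last ` set Qs = W k"
  using assms
proof (induction k)
  case 0
  obtain xs where xs: "set xs = W 0" "distinct xs" using finite_distinct_list[OF 0(3)] by blast
  define Qs where "Qs = map (\<lambda>x. [x]) xs"
  have Qs: "concat Qs = xs" "map last Qs = xs" "length Qs = card (W 0)"
    using xs distinct_card[of xs] by (simp_all add: Qs_def comp_def)
  have "last ` set Qs = set (map last Qs)" by simp
  then have "last ` set Qs = W 0" unfolding Qs(2) xs(1) .
  moreover have "\<forall>Q\<in>set Qs. dipath E Q" by (auto simp: Qs_def dipath_def)
  ultimately show ?case using Qs xs by (intro exI[of _ Qs]) simp
next
  case (Suc k)
  have "\<exists>Qs. length Qs = card (W 0) \<and> (\<forall>Q\<in>set Qs. dipath E Q) \<and> distinct (concat Qs) \<and>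
    set (concat Qs) = (\<Union>i\<le>k. W i) \<and> distinct (map last Qs) \<and> last ` set Qs = W k"
    using Suc.prems by (intro Suc.IH) auto
  then obtain Qs where Qs: "length Qs = card (W 0)" "\<forall>Q\<in>set Qs. dipath E Q" "distinct (concat Qs)"
    "set (concat Qs) = (\<Union>i\<le>k. W i)" "distinct (map last Qs)" "last ` set Qs = W k"
    by (elim exE conjE) (rule that, assumption+)
  obtain f where f: "bij_betw f (W k) (W (Suc k))" "\<And>x. x \<in> W k \<Longrightarrow> E x (f x)" using Suc.prems(1)[of k] by auto
  define g where "g Q = f (last Q)" for Q
  define Rs where "Rs = map (\<lambda>Q. Q @ [g Q]) Qs"
  have mset: "mset (concat (map (\<lambda>Q. Q @ [g Q]) Ps)) = mset (concat Ps @ map g Ps)" for Ps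
    by (induction Ps) auto
  have gset: "g ` set Qs = W (Suc k)"
    using f(1) Qs(6) unfolding g_def bij_betw_def by (metis image_image)
  have "W (Suc k) \<inter> W i = {}" if "i \<le> k" for i using that by (intro Suc.prems(2)) auto
  then have new: "W (Suc k) \<inter> (\<Union>i\<le>k. W i) = {}" by blast
  have "distinct (map f (map last Qs))"
    using Qs(5,6) f(1) by (subst distinct_map) (simp add: bij_betw_def)
  moreover have "g = f \<circ> last" by (simp add: g_def fun_eq_iff)
  ultimately have dg: "distinct (map g Qs)" by simp
  have "distinct (concat Qs @ map g Qs)"
    using Qs(3,4) dg gset new by auto
  then have "distinct (concat Rs)"
    using mset_eq_imp_distinct_iff[OF mset[of Qs]] by (simp add: Rs_def)
  moreover have "set (concat Rs) = (\<Union>i\<le>Suc k. W i)"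
  proof -
    have "set (concat Rs) = set (concat Qs @ map g Qs)"
      unfolding Rs_def using mset[of Qs] by (metis set_mset_mset)
    then show ?thesis using Qs(4) gset by (auto simp: atMost_Suc)
  qed
  moreover have "dipath E R" if R: "R \<in> set Rs" for R
  proof -
    obtain Q where Q: "Q \<in> set Qs" "R = Q @ [g Q]" using R by (auto simp: Rs_def)
    have "last Q \<in> W k" using Q(1) Qs(6) by blast
    then have "E (last Q) (g Q)" by (simp add: f(2) g_def)
    moreover have "g Q \<in> W (Suc k)" using Q(1) gset by blast
    moreover have "set Q \<subseteq> (\<Union>i\<le>k. W i)" using Q(1) Qs(4) by auto
    ultimately have "g Q \<notin> set Q" "E (last Q) (g Q)" using new by blast+
    then show ?thesis using Q(2) bspec[OF Qs(2) Q(1)] by (auto simp: dipath_def successively_append_iff)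
  qed
  moreover have "distinct (map last Rs)" using dg by (simp add: Rs_def comp_def)
  moreover have "last ` set Rs = W (Suc k)" using gset by (simp add: Rs_def image_image)
  moreover have "length Rs = card (W 0)" using Qs(1) by (simp add: Rs_def)
  ultimately show ?case by blast
qed

text \<open>A prefix of the concatenation cuts at most one path and drops the later ones, so any
  number of vertices can be kept without needing more paths.\<close>

lemma truncate_paths:
  assumes "\<And>Q. Q \<in> set Qs \<Longrightarrow> dipath E Q"
  shows "\<exists>Qs'. concat Qs' = take r (concat Qs) \<and> length Qs' \<le> length Qs \<and> (\<forall>Q\<in>set Qs'. dipath E Q)"
  using assms
proof (induction Qs arbitrary: r)
  case (Cons Q Qs)
  show ?case
  proof (cases "r = 0")
    case False
    have Q: "dipath E Q" using Cons.prems by simp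
    have "successively E (take r Q)"
      using Q append_take_drop_id[of r Q] unfolding dipath_def by (metis successively_append_iff)
    then have tQ: "dipath E (take r Q)" using Q False by (simp add: dipath_def)
    obtain Qs' where "concat Qs' = take (r - length Q) (concat Qs)" "length Qs' \<le> length Qs" "\<forall>Q\<in>set Qs'. dipath E Q"
      using Cons.IH[of "r - length Q"] Cons.prems by auto
    then show ?thesis using tQ by (intro exI[of _ "take r Q # Qs'"]) auto
  qed (intro exI[of _ "[]"], simp)
qed simp

text \<open>At most \<open>m\<close> paths run through the \<open>card V div m\<close> layers; the
  fewer than \<open>m\<close> remaining vertices become paths of one vertex.\<close>

lemma (in robust_system) path_cover:
  assumes m: "0 < m" "64 * (card V / c)\<^sup>2 * (card V / b + 3) * ln (card V) < m" and n6: "6 \<le> card V"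
  shows "\<exists>Qs. length Qs \<le> 2 * m \<and> (\<forall>Q\<in>set Qs. dipath E Q) \<and> distinct (concat Qs) \<and> set (concat Qs) = V"
proof -
  define k where "k = card V div m"
  have km: "k * m \<le> card V" "card V < k * m + m"
    using m(1) dividend_less_div_times[of m "card V"] unfolding k_def by simp_all
  obtain W where W: "\<And>i. i < k \<Longrightarrow> sample m (W i)" "\<And>i j. i < k \<Longrightarrow> j < k \<Longrightarrow> i \<noteq> j \<Longrightarrow> W i \<inter> W j = {}"
    using samples_exist[OF km(1) m(1) n6 m(2)] by blast
  have WV: "W i \<subseteq> V" "card (W i) = m" "finite (W i)" if "i < k" for i
    using W(1)[OF that] finite_V finite_subset by (auto simp: sample_def)
  let ?C = "\<Union>i<k. W i"
  have "\<exists>Qs. length Qs \<le> m \<and> (\<forall>Q\<in>set Qs. dipath E Q) \<and> distinct (concat Qs) \<and> set (concat Qs) = ?C"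
  proof (cases k)
    case (Suc k')
    have "\<exists>Qs. length Qs = card (W 0) \<and> (\<forall>Q\<in>set Qs. dipath E Q) \<and> distinct (concat Qs) \<and>
      set (concat Qs) = (\<Union>i\<le>k'. W i) \<and> distinct (map last Qs) \<and> last ` set Qs = W k'"
      using Suc W WV by (intro layers_path_cover sample_perfect_matching) auto
    moreover have "{..<k} = {..k'}" using Suc by auto
    moreover have "card (W 0) \<le> m" using WV(2)[of 0] Suc by simp
    ultimately show ?thesis by metis
  qed (intro exI[of _ "[]"], simp)
  then obtain Qs where Qs: "length Qs \<le> m" "\<forall>Q\<in>set Qs. dipath E Q" "distinct (concat Qs)" "set (concat Qs) = ?C"
    by blast
  have "card ?C = k * m"
    using WV W(2) by (subst card_UN_disjoint) auto
  moreover have "?C \<subseteq> V" using WV by auto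
  ultimately have left: "card (V - ?C) \<le> m"
    using finite_V km(2) by (simp add: card_Diff_subset finite_subset)
  obtain xs where xs: "set xs = V - ?C" "distinct xs" using finite_distinct_list[of "V - ?C"] finite_V by auto
  have "concat (Qs @ map (\<lambda>x. [x]) xs) = concat Qs @ xs" by simp
  moreover have "length xs \<le> m" using xs left distinct_card by metis
  moreover have "dipath E Q" if "Q \<in> set (Qs @ map (\<lambda>x. [x]) xs)" for Q
    using that Qs(2) by (auto simp: dipath_def)
  ultimately show ?thesis using Qs xs \<open>?C \<subseteq> V\<close> by (intro exI[of _ "Qs @ map (\<lambda>x. [x]) xs"]) auto
qed

section \<open>Cycles through a given vertex\<close>

lemma distinct_endpoints:
  assumes "distinct (map fst es @ map snd es)"
  shows "distinct (endpoints es)"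
proof -
  have "mset (endpoints es) = mset (map fst es @ map snd es)" by (induction es) auto
  then show ?thesis using assms by (metis mset_eq_imp_distinct_iff)
qed

lemma distinct_concat_map_upt:
  assumes "\<And>i. i < k \<Longrightarrow> distinct (g i)" "\<And>i j. i < k \<Longrightarrow> j < k \<Longrightarrow> i \<noteq> j \<Longrightarrow> set (g i) \<inter> set (g j) = {}"
  shows "distinct (concat (map g [0..<k]))"
  using assms
proof (induction k)
  case (Suc k)
  have "set (g i) \<inter> set (g k) = {}" if "i < k" for i using that by (intro Suc.prems(2)) auto
  then have "(\<Union>i\<in>{0..<k}. set (g i)) \<inter> set (g k) = {}" by force
  then have "set (concat (map g [0..<k])) \<inter> set (g k) = {}" by simp
  moreover have "distinct (concat (map g [0..<k]))" "distinct (g k)" using Suc by auto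
  ultimately show ?case by simp
qed simp

text \<open>The hypotheses of the theorem in absolute numbers: \<open>\<beta>\<close> is
  \<open>\<nu> n\<close>, \<open>lo\<close> is \<open>\<tau> n\<close>, and \<open>16 * lo\<close>
  comes from \<open>\<tau> \<le> \<gamma> / 16\<close>.\<close>

locale robust_digraph =
  fixes V :: "'a set" and E :: "'a \<Rightarrow> 'a \<Rightarrow> bool" and \<beta> lo :: real
  assumes finite_V: "finite V" and V_nonempty: "V \<noteq> {}" and \<beta>: "0 < \<beta>" "\<beta> \<le> lo"
    and arcs: "E x y \<Longrightarrow> x \<in> V \<and> y \<in> V"
    and outdegree: "x \<in> V \<Longrightarrow> 16 * lo \<le> card {y \<in> V. E x y}"
    and indegree: "y \<in> V \<Longrightarrow> 16 * lo \<le> card {x \<in> V. E x y}"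
    and expands: "S \<subseteq> V \<Longrightarrow> lo \<le> card S \<Longrightarrow> card S \<le> card V - lo \<Longrightarrow>
      card S + \<beta> \<le> card {y \<in> V. \<beta> \<le> card {x \<in> S. E x y}}"
begin

lemma card_restrict_ge:
  assumes "U \<subseteq> V"
  shows "real (card {z \<in> V. P z}) - card U \<le> card {z \<in> V - U. P z}"
proof -
  have "card {z \<in> V. P z} \<le> card ({z \<in> V - U. P z} \<union> U)"
    using assms finite_V finite_subset by (intro card_mono) auto
  also have "\<dots> \<le> card {z \<in> V - U. P z} + card U" by (rule card_Un_le)
  finally show ?thesis by simp
qed

lemma card_bounds: "16 * \<beta> \<le> card V" "0 < card V"
proof -
  obtain v where "v \<in> V" using V_nonempty by blast
  then have "16 * lo \<le> card {y \<in> V. E v y}" by (rule outdegree)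
  also have "\<dots> \<le> card V" using finite_V by (simp add: card_mono)
  finally show "16 * \<beta> \<le> card V" using \<beta> by simp
  then show "0 < card V" using \<beta> by linarith
qed

text \<open>Deleting \<open>U\<close> costs at most \<open>\<beta> / 2\<close> of the expansion
  surplus \<open>\<beta>\<close>, and the other half becomes the parameter \<open>c\<close>. The
  degrees far exceed what is required.\<close>

lemma subsystem:
  assumes U: "U \<subseteq> V" "card U \<le> \<beta> / 2"
  shows "robust_system (V - U) E \<beta> (\<beta> / 2) lo"
proof
  have finU: "finite U" using U finite_V finite_subset by blast
  have cVU: "real (card (V - U)) = card V - real (card U)"
    using U finU finite_V by (simp add: card_Diff_subset of_nat_diff card_mono)
  show "finite (V - U)" using finite_V by simp
  show "V - U \<noteq> {}"
  proof
    assume "V - U = {}"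
    then have "card V \<le> card U" using finU by (intro card_mono) auto
    then show False using U card_bounds \<beta> by linarith
  qed
  show "0 < \<beta>" "0 < \<beta> / 2" using \<beta> by auto
  show "lo + \<beta> / 2 \<le> card {y \<in> V - U. E x y}" if "x \<in> V - U" for x
    using outdegree[of x] card_restrict_ge[OF U(1), of "E x"] that U(2) \<beta> by simp
  show "\<beta> / 2 \<le> card {x \<in> V - U. E x y}" if "y \<in> V - U" for y
    using indegree[of y] card_restrict_ge[OF U(1), of "\<lambda>x. E x y"] that U(2) \<beta> by simp
  fix X assume X: "X \<subseteq> V - U" "lo \<le> card X"
  let ?F = "{y \<in> V - U. real (card {x \<in> X. E x y}) < \<beta>}"
  have finX: "finite X" using X finite_V finite_subset by blast
  show "?F = {} \<or> real (card ?F) + card X \<le> card (V - U) - \<beta> / 2"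
  proof (cases "card X \<le> card V - lo")
    case True
    let ?R = "{y \<in> V. \<beta> \<le> card {x \<in> X. E x y}}"
    have "card X + \<beta> \<le> card ?R" using X True by (intro expands) auto
    then have "card X + \<beta> / 2 \<le> card {z \<in> V - U. \<beta> \<le> card {x \<in> X. E x z}}"
      using card_restrict_ge[OF U(1), of "\<lambda>y. \<beta> \<le> card {x \<in> X. E x y}"] U(2) by linarith
    moreover have "card ?F + card {z \<in> V - U. \<beta> \<le> card {x \<in> X. E x z}} = card (V - U)"
    proof -
      have "V - U = ?F \<union> {z \<in> V - U. \<beta> \<le> card {x \<in> X. E x z}}" by auto
      moreover have "?F \<inter> {z \<in> V - U. \<beta> \<le> card {x \<in> X. E x z}} = {}" by auto
      ultimately show ?thesis using finite_V
        by (metis (no_types, lifting) card_Un_disjoint finite_Diff finite_Un)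
    qed
    ultimately show ?thesis by linarith
  next
    \<comment> \<open>Fewer than \<open>lo\<close> vertices lie outside \<open>X\<close>, so the
      indegree \<open>16 * lo\<close> gives every vertex at least \<open>\<beta>\<close>
      inneighbours in \<open>X\<close>.\<close>
    case False
    have "\<beta> \<le> card {x \<in> X. E x y}" if y: "y \<in> V" for y
    proof -
      have "{x \<in> V. E x y} \<subseteq> {x \<in> X. E x y} \<union> (V - X)" by auto
      then have "card {x \<in> V. E x y} \<le> card ({x \<in> X. E x y} \<union> (V - X))"
        using finite_V finX by (intro card_mono) auto
      also have "\<dots> \<le> card {x \<in> X. E x y} + card (V - X)" by (rule card_Un_le)
      finally have "16 * lo \<le> card {x \<in> X. E x y} + card (V - X)" using indegree[OF y] by linarith
      moreover have "real (card (V - X)) = card V - real (card X)"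
        using X finX finite_V by (subst card_Diff_subset) (auto intro!: of_nat_diff card_mono)
      ultimately show ?thesis using False \<beta> by linarith
    qed
    then show ?thesis by force
  qed
qed

text \<open>The ends themselves may lie in \<open>U\<close>, as they only need neighbours outside
  it; in the applications both lie on structures already built.\<close>

lemma connect_avoiding:
  assumes U: "U \<subseteq> V" "card U \<le> \<beta> / 2" and xy: "x \<in> V" "y \<in> V"
  shows "\<exists>C. set C \<subseteq> V - U \<and> distinct C \<and> length C \<le> nat \<lceil>2 * card V / \<beta>\<rceil> + 2 \<and> successively E (x # C @ [y])"
proof -
  interpret R: robust_system "V - U" E \<beta> "\<beta> / 2" lo using U by (rule subsystem)
  have "lo \<le> card {z \<in> V - U. E x z}"
    using outdegree[OF xy(1)] card_restrict_ge[OF U(1), of "E x"] U(2) \<beta> by simp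
  moreover have "\<exists>z\<in>V - U. E z y"
  proof -
    have "0 < card {z \<in> V - U. E z y}"
      using indegree[OF xy(2)] card_restrict_ge[OF U(1), of "\<lambda>z. E z y"] U(2) \<beta> by simp
    then show ?thesis by (auto simp: card_gt_0_iff)
  qed
  ultimately obtain C where C: "set C \<subseteq> V - U" "distinct C"
    "length C \<le> nat \<lceil>card (V - U) / (\<beta> / 2)\<rceil> + 2" "successively E (x # C @ [y])"
    using R.connector_exists by blast
  have "card (V - U) \<le> card V" using finite_V by (intro card_mono) auto
  then have "card (V - U) / (\<beta> / 2) \<le> 2 * card V / \<beta>" using \<beta> by (simp add: field_simps)
  then have "nat \<lceil>card (V - U) / (\<beta> / 2)\<rceil> \<le> nat \<lceil>2 * card V / \<beta>\<rceil>" by (intro nat_mono ceiling_mono)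
  then have "length C \<le> nat \<lceil>2 * card V / \<beta>\<rceil> + 2" using C(3) by linarith
  then show ?thesis using C by blast
qed

text \<open>No arc leads from the tails of \<open>S\<close> to the heads of the arcs outside
  \<open>S'\<close>, so \<open>sample_expands\<close> applies. Its surplus with
  \<open>c = \<beta> / 2\<close> is the stated rate.\<close>

lemma matching_levels_expanding:
  assumes sys: "robust_system V E \<beta> (\<beta> / 2) lo"
    and l: "robust_system.sample V E \<beta> (\<beta> / 2) m (fst ` set l)" "inj_on fst (set l)"
    and l': "robust_system.sample V E \<beta> (\<beta> / 2) m (snd ` set l')" "inj_on snd (set l')"
  shows "expanding E (\<beta> / (4 * card V) * m) l l'"
  unfolding expanding_def Let_def
proof (intro allI impI)
  interpret R: robust_system V E \<beta> "\<beta> / 2" lo by (rule sys)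
  fix S assume S: "S \<subseteq> set l" "S \<noteq> {}"
  define S' where "S' = {e' \<in> set l'. \<exists>e\<in>S. E (fst e) (snd e')}"
  have "real (card S) + \<beta> / (4 * card V) * m \<le> card S'" if ne: "S' \<noteq> set l'"
  proof -
    define T where "T = set l' - S'"
    have "T \<noteq> {}" using ne by (auto simp: T_def S'_def)
    then have "real (card (fst ` S)) + card (snd ` T) \<le> m - \<beta> / 2 / (2 * card V) * m"
      using S by (intro R.sample_expands[OF l(1) l'(1)]) (auto simp: T_def S'_def)
    moreover have "card (fst ` S) = card S" using S l(2) by (meson card_image inj_on_subset)
    moreover have "card (snd ` T) = card T" using l'(2) by (intro card_image) (auto simp: T_def inj_on_subset)
    moreover have "card (set l') = m" using l' by (simp add: R.sample_def card_image)
    moreover have "real (card T) = card (set l') - real (card S')"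
      unfolding T_def by (subst card_Diff_subset) (auto simp: S'_def intro!: of_nat_diff card_mono)
    ultimately show ?thesis by (simp add: field_simps)
  qed
  then show "{e' \<in> set l'. \<exists>e\<in>S. E (fst e) (snd e')} = set l' \<or>
      real (card S) + \<beta> / (4 * card V) * m \<le> card {e' \<in> set l'. \<exists>e\<in>S. E (fst e) (snd e')}"
    unfolding S'_def by blast
qed

text \<open>Each of the \<open>Suc s * t\<close> levels is a perfect matching between two samples of
  its own. The size bound charges every arc with its two ends and a connector of at most
  \<open>K\<close> vertices.\<close>

lemma absorbing_cycle:
  fixes m s t K :: nat
  defines "K \<equiv> nat \<lceil>2 * card V / \<beta>\<rceil> + 2"
  assumes m: "0 < m" "64 * (card V / (\<beta> / 2))\<^sup>2 * (card V / \<beta> + 3) * ln (card V) < m" and n6: "6 \<le> card V"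
    and t: "odd t" "4 * (card V / \<beta>) < real (t - 1)"
    and size: "real (Suc s * t * m * (K + 2)) \<le> \<beta> / 2"
  shows "\<exists>A. absorber E V (Suc s) A \<and> E (last A) (hd A) \<and> set A \<subseteq> V \<and> length A \<le> Suc s * t * m * (K + 2)"
proof -
  interpret R: robust_system V E \<beta> "\<beta> / 2" lo using subsystem[of "{}"] \<beta> by simp
  define N where "N = Suc s * t"
  have "N * m * 2 \<le> N * m * (K + 2)" by (intro mult_le_mono2) simp
  then have "real (2 * N * m) \<le> real (Suc s * t * m * (K + 2))"
    unfolding N_def of_nat_le_iff by (simp only: mult_ac)
  also have "\<dots> \<le> card V" using size card_bounds \<beta> by linarith
  finally have km: "2 * N * m \<le> card V" by linarith
  obtain W where W: "\<And>i. i < 2 * N \<Longrightarrow> R.sample m (W i)"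
    "\<And>i j. i < 2 * N \<Longrightarrow> j < 2 * N \<Longrightarrow> i \<noteq> j \<Longrightarrow> W i \<inter> W j = {}"
    using R.samples_exist[OF km m(1) n6 m(2)] by blast
  have WV: "W i \<subseteq> V" "card (W i) = m" "finite (W i)" if "i < 2 * N" for i
    using W(1)[OF that] finite_V finite_subset by (auto simp: R.sample_def)
  have "\<forall>i<N. \<exists>l. distinct l \<and> length l = m \<and> inj_on fst (set l) \<and> inj_on snd (set l) \<and>
    fst ` set l = W (2 * i) \<and> snd ` set l = W (2 * i + 1) \<and> (\<forall>e\<in>set l. E (fst e) (snd e))"
  proof (intro allI impI)
    fix i assume i: "i < N"
    then have i2: "2 * i < 2 * N" "2 * i + 1 < 2 * N" by auto
    obtain f where f: "bij_betw f (W (2 * i)) (W (2 * i + 1))" "\<forall>x\<in>W (2 * i). E x (f x)"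
      using R.sample_perfect_matching[OF W(1)[OF i2(1)] W(1)[OF i2(2)]] by blast
    obtain xs where xs: "set xs = W (2 * i)" "distinct xs" using finite_distinct_list[OF WV(3)[OF i2(1)]] by blast
    have "length xs = m" using xs WV(2)[OF i2(1)] distinct_card by metis
    then show "\<exists>l. distinct l \<and> length l = m \<and> inj_on fst (set l) \<and> inj_on snd (set l) \<and>
      fst ` set l = W (2 * i) \<and> snd ` set l = W (2 * i + 1) \<and> (\<forall>e\<in>set l. E (fst e) (snd e))"
      using xs f by (intro exI[of _ "map (\<lambda>x. (x, f x)) xs"])
        (auto simp: distinct_map inj_on_def bij_betw_def image_image)
  qed
  then obtain l where l: "\<And>i. i < N \<Longrightarrow> distinct (l i) \<and> length (l i) = m \<and> inj_on fst (set (l i)) \<and> inj_on snd (set (l i)) \<and>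
    fst ` set (l i) = W (2 * i) \<and> snd ` set (l i) = W (2 * i + 1) \<and> (\<forall>e\<in>set (l i). E (fst e) (snd e))"
    by metis
  define L where "L = map l [0..<N]"
  have lenL: "length L = Suc s * t" by (simp add: L_def N_def)
  have Lmem: "\<exists>i<N. k = l i" if "k \<in> set L" for k using that by (auto simp: L_def)
  have ends: "set (endpoints (l i)) = W (2 * i) \<union> W (2 * i + 1)" if "i < N" for i
    using l[OF that] by (simp add: set_endpoints)
  have dist: "distinct (concat (map endpoints L))"
  proof -
    have "distinct (concat (map (endpoints \<circ> l) [0..<N]))"
    proof (rule distinct_concat_map_upt)
      fix i assume i: "i < N"
      have "W (2 * i) \<inter> W (2 * i + 1) = {}" using i by (intro W(2)) auto
      then show "distinct ((endpoints \<circ> l) i)"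
        using l[OF i] unfolding comp_def by (intro distinct_endpoints) (simp add: distinct_map)
    next
      fix i j assume ij: "i < N" "j < N" "i \<noteq> j"
      have "W p \<inter> W q = {}" if "p \<in> {2 * i, 2 * i + 1}" "q \<in> {2 * j, 2 * j + 1}" for p q
      proof -
        have "p div 2 = i" "q div 2 = j" using that by auto
        then have "p < 2 * N" "q < 2 * N" "p \<noteq> q" using ij by presburger+
        then show ?thesis by (rule W(2))
      qed
      then show "set ((endpoints \<circ> l) i) \<inter> set ((endpoints \<circ> l) j) = {}"
        using ends[OF ij(1)] ends[OF ij(2)] by (simp add: Int_Un_distrib Int_Un_distrib2)
    qed
    then show ?thesis by (simp add: L_def)
  qed
  have lenc: "length (concat L) = N * m"
  proof -
    have "length (concat (map l [0..<k])) = k * m" if "k \<le> N" for k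
      using that l by (induction k) auto
    then show ?thesis by (simp add: L_def)
  qed
  define U where "U = set (concat (map endpoints L))"
  have "length (endpoints es) = 2 * length es" for es :: "('a \<times> 'a) list" by (induction es) auto
  then have "length (concat (map endpoints L)) = 2 * length (concat L)"
    by (induction L) auto
  then have cardU: "card U \<le> 2 * N * m" unfolding U_def using lenc card_length[of "concat (map endpoints L)"] by simp
  have UV: "U \<subseteq> V"
  proof -
    have "set (endpoints k) \<subseteq> V" if k: "k \<in> set L" for k
    proof -
      obtain i where "i < N" "k = l i" using Lmem[OF k] by blast
      then show ?thesis using ends[of i] WV(1)[of "2 * i"] WV(1)[of "2 * i + 1"] by auto
    qed
    then show ?thesis by (auto simp: U_def)
  qed
  have "0 < t" using t(1) by (rule odd_pos)
  then have "L \<noteq> []" using lenL by auto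
  have Lne: "[] \<notin> set L" using l m(1) by (fastforce simp: L_def)
  then have endne: "concat (map endpoints L) \<noteq> []"
    using \<open>L \<noteq> []\<close> by (cases L; cases "hd L") auto
  \<comment> \<open>Aiming the last connector at the very first end of an arc closes the path to a
    cycle.\<close>
  define y where "y = hd (concat (map endpoints L))"
  have "y \<in> U" unfolding U_def y_def by (rule hd_in_set[OF endne])
  then have yV: "y \<in> V" using UV by blast
  have "\<exists>Zs. list_all2 (level_path E) Zs L \<and> distinct (concat Zs) \<and> successively E (concat Zs @ [y]) \<and>
    hd (concat Zs @ [y]) = hd (concat (map endpoints L) @ [y]) \<and>
    set (concat Zs) \<inter> U = set (concat (map endpoints L)) \<and> set (concat Zs) \<subseteq> V \<and>
    card (U \<union> set (concat Zs)) \<le> card U + K * length (concat L)"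
  proof (rule level_paths_exist[OF _ UV _ yV _ dist _ Lne])
    show "\<exists>C. set C \<subseteq> V - U' \<and> distinct C \<and> length C \<le> K \<and> successively E (x # C @ [z])"
      if "U' \<subseteq> V" "card U' \<le> Suc s * t * m * (K + 2)" "x \<in> V" "z \<in> V" for U' x z
      unfolding K_def using that size by (intro connect_avoiding) linarith+
    show "card U + K * length (concat L) \<le> Suc s * t * m * (K + 2)"
      using cardU unfolding lenc N_def by (simp add: algebra_simps)
    show "E (fst e) (snd e)" if "e \<in> set (concat L)" for e
      using that l by (auto simp: L_def)
  qed (simp add: U_def)
  then obtain Zs where Zs: "list_all2 (level_path E) Zs L" "distinct (concat Zs)" "successively E (concat Zs @ [y])"
    "hd (concat Zs @ [y]) = hd (concat (map endpoints L) @ [y])"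
    "set (concat Zs) \<inter> U = set (concat (map endpoints L))" "set (concat Zs) \<subseteq> V"
    "card (U \<union> set (concat Zs)) \<le> card U + K * length (concat L)"
    by (elim exE conjE) (rule that, assumption+)
  have Zne: "concat Zs \<noteq> []"
  proof
    assume "concat Zs = []"
    then have "set (concat (map endpoints L)) = {}" using Zs(5) by (simp only: list.set Int_empty_left)
    then show False using endne by (simp only: set_empty)
  qed
  have path: "dipath E (concat Zs)" "E (last (concat Zs)) y"
    using Zs(2,3) Zne by (auto simp: dipath_def successively_append_iff)
  have hdy: "hd (concat Zs) = y" using Zs(4) Zne endne by (simp add: y_def)
  have "length (concat Zs) = card (set (concat Zs))" using Zs(2) distinct_card by metis
  also have "\<dots> \<le> card (U \<union> set (concat Zs))" using UV finite_V finite_subset by (intro card_mono) auto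
  also have "\<dots> \<le> Suc s * t * m * (K + 2)"
    using Zs(7) cardU unfolding lenc N_def by (simp add: algebra_simps)
  finally have len: "length (concat Zs) \<le> Suc s * t * m * (K + 2)" .
  \<comment> \<open>The growth rate per level; \<open>4 * (card V / \<beta>)\<close> times
    \<open>g\<close> is \<open>m\<close>, which is where the lower bound on \<open>t - 1\<close>
    comes from.\<close>
  define g where "g = \<beta> / (4 * card V) * m"
  have lo: "0 \<le> lo" using \<beta> by simp
  have "absorber E V (Suc s) (concat Zs)"
  proof (rule levels_absorb[OF lenL t(1) _ Zs(1) path(1) _ _ m(1)])
    show "0 < g" using \<beta> card_bounds(2) m(1) by (simp add: g_def)
    have "4 * (card V / \<beta>) * g < real (t - 1) * g" using t(2) \<open>0 < g\<close> by (rule mult_strict_right_mono)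
    moreover have "4 * (card V / \<beta>) * g = m" using \<beta> card_bounds(2) by (simp add: g_def)
    ultimately show "real m < real (t - 1) * g" by (simp only:)
    show "card (set k) = m" if "k \<in> set L" for k
      using Lmem[OF that] l distinct_card by metis
    show "expanding E g k k'" if kk': "k \<in> set L" "k' \<in> set L" for k k'
    proof -
      obtain i j where ij: "i < N" "k = l i" "j < N" "k' = l j" using Lmem[OF kk'(1)] Lmem[OF kk'(2)] by metis
      then show ?thesis unfolding g_def using l[of i] l[of j] W(1)[of "2 * i"] W(1)[of "2 * j + 1"]
        by (intro matching_levels_expanding R.robust_system_axioms) auto
    qed
    show "\<exists>e\<in>set k. E w (snd e)" if k: "k \<in> set L" "w \<in> V" for k w
    proof -
      obtain i where i: "i < N" "k = l i" using Lmem[OF k(1)] by blast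
      then have "\<exists>z\<in>W (2 * i + 1). E w z" using k m(1) lo by (intro R.sample_outneighbour[OF W(1)]) auto
      then have "\<exists>z\<in>snd ` set (l i). E w z" using l[OF i(1)] by simp
      then show ?thesis using i by blast
    qed
    show "\<exists>e\<in>set k. E (fst e) u" if k: "k \<in> set L" "u \<in> V" for k u
    proof -
      obtain i where i: "i < N" "k = l i" using Lmem[OF k(1)] by blast
      then have "\<exists>z\<in>W (2 * i). E z u" using k m(1) by (intro R.sample_inneighbour[OF W(1)]) auto
      then have "\<exists>z\<in>fst ` set (l i). E z u" using l[OF i(1)] by simp
      then show ?thesis using i by blast
    qed
  qed
  then show ?thesis using path(2) hdy Zs(6) len by (intro exI[of _ "concat Zs"]) auto
qed

text \<open>At most \<open>2 * m\<close> paths cover what the cycle and \<open>v\<close> leave over,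
  and \<open>v\<close> counts as one more path if it is not on the cycle: hence
  \<open>Suc (2 * m)\<close>. Truncating the cover to \<open>k - card U\<close> vertices gives
  length \<open>k\<close>, and \<open>k \<ge> \<beta> / 2\<close> ensures that this difference is
  not cut off at 0.\<close>

lemma cycle_from_absorber:
  assumes m: "0 < m" "64 * (card V / (\<beta> / 2))\<^sup>2 * (card V / \<beta> + 3) * ln (card V) < m" and n6: "12 \<le> card V"
    and A: "absorber E V (Suc (2 * m)) A" "E (last A) (hd A)" "set A \<subseteq> V" "real (length A) + 1 \<le> \<beta> / 2"
    and v: "v \<in> V" and k: "\<beta> / 2 \<le> real k" "k \<le> card V"
  shows "\<exists>Z. dipath E Z \<and> E (last Z) (hd Z) \<and> length Z = k \<and> v \<in> set Z"
proof -
  have dA: "distinct A" using A(1) by (simp add: absorber_def dipath_def)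
  then have cA: "card (set A) = length A" by (rule distinct_card)
  define P where "P = (if v \<in> set A then [] else [[v]])"
  have P: "concat P = (if v \<in> set A then [] else [v])" "\<forall>Q\<in>set P. dipath E Q" "length P \<le> 1"
    by (auto simp: P_def dipath_def)
  define U where "U = set A \<union> {v}"
  have U: "U = set (A @ concat P)" "distinct (A @ concat P)" using dA P(1) by (auto simp: U_def)
  then have cU: "card U = length A + length (concat P)" by (metis distinct_card length_append)
  then have cU1: "card U \<le> length A + 1" using P(1) by simp
  have UV: "U \<subseteq> V" using A(3) v by (simp add: U_def)
  have Ub: "card U \<le> \<beta> / 2" using cU1 A(4) by linarith
  interpret R: robust_system "V - U" E \<beta> "\<beta> / 2" lo using UV Ub by (rule subsystem)
  have cVU: "card (V - U) = card V - card U" using UV finite_V by (intro card_Diff_subset) (auto intro: finite_subset)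
  have le: "card (V - U) \<le> card V" using finite_V by (intro card_mono) auto
  \<comment> \<open>At least half of the vertices remain, so 12 vertices in \<open>V\<close> provide
    the 6 that \<open>path_cover\<close> requires.\<close>
  have half: "12 \<le> 2 * real (card (V - U))"
    using cVU Ub card_bounds(1) n6 \<beta> by linarith
  \<comment> \<open>The required sample size increases with the number of vertices, so the same
    \<open>m\<close> works for the remaining system.\<close>
  have "64 * (card (V - U) / (\<beta> / 2))\<^sup>2 * (card (V - U) / \<beta> + 3) * ln (card (V - U))
    \<le> 64 * (card V / (\<beta> / 2))\<^sup>2 * (card V / \<beta> + 3) * ln (card V)"
    using le \<beta> half by (intro mult_mono power_mono divide_right_mono add_mono ln_mono) auto
  then have "64 * (card (V - U) / (\<beta> / 2))\<^sup>2 * (card (V - U) / \<beta> + 3) * ln (card (V - U)) < m"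
    using m(2) by linarith
  then obtain Qs where Qs: "length Qs \<le> 2 * m" "\<forall>Q\<in>set Qs. dipath E Q" "distinct (concat Qs)" "set (concat Qs) = V - U"
    using R.path_cover[OF m(1)] half by auto
  define r where "r = k - card U"
  have kU: "card U \<le> k" using Ub k(1) by linarith
  obtain Qs' where Qs': "concat Qs' = take r (concat Qs)" "length Qs' \<le> length Qs" "\<forall>Q\<in>set Qs'. dipath E Q"
    using truncate_paths[of Qs E r] Qs(2) by blast
  have "length (concat Qs) = card (V - U)" using Qs(3,4) distinct_card by metis
  then have lenr: "length (concat Qs') = r" using Qs'(1) k(2) cVU unfolding r_def by simp
  have sub: "set (concat Qs') \<subseteq> V - U" using Qs'(1) Qs(4) set_take_subset by metis
  have dist: "distinct (concat Qs')" using Qs'(1) Qs(3) by simp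
  have disj: "set (A @ concat P) \<inter> set (concat Qs') = {}" using sub U(1) by blast
  then have distall: "distinct (concat (P @ Qs'))" using U(2) dist by auto
  have "set (concat (P @ Qs')) \<subseteq> V - set A"
    using sub U UV P(1) v by (auto simp: U_def)
  then obtain Z where Z: "dipath E Z" "hd Z = hd A" "last Z = last A" "set Z = set A \<union> set (concat (P @ Qs'))"
    using absorberD[OF A(1), of "P @ Qs'"] P(2,3) Qs'(2,3) Qs(1) distall by auto
  have setZ: "set Z = set ((A @ concat P) @ concat Qs')" unfolding Z(4) by auto
  have "length Z = card (set Z)" using Z(1) distinct_card[of Z] by (simp add: dipath_def)
  also have "\<dots> = length ((A @ concat P) @ concat Qs')"
    unfolding setZ using U(2) dist disj by (intro distinct_card) auto
  also have "\<dots> = k" using cU lenr kU by (simp add: r_def)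
  finally have "length Z = k" .
  moreover have "v \<in> set Z" unfolding Z(4) using P(1) by (auto split: if_splits)
  moreover have "E (last Z) (hd Z)" using Z(2,3) A(2) by simp
  ultimately show ?thesis using Z(1) by blast
qed

lemma cycle_through_vertex:
  assumes n2: "2 \<le> card V" and large: "(ln (card V))\<^sup>2 * (4 * (card V / \<beta>)) ^ 13 < card V"
    and v: "v \<in> V" and k: "\<beta> / 2 \<le> real k" "k \<le> card V"
  shows "\<exists>Z. dipath E Z \<and> E (last Z) (hd Z) \<and> length Z = k \<and> v \<in> set Z"
proof -
  define x where "x = card V / \<beta>"
  define \<L> where "\<L> = ln (card V)"
  have x16: "16 \<le> x" using card_bounds(1) \<beta> by (simp add: x_def pos_le_divide_eq)
  have Vx: "real (card V) = x * \<beta>" using \<beta> by (simp add: x_def)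
  \<comment> \<open>Two vertices give only \<open>\<L> \<ge> 1 / 2\<close>. Together with
    \<open>x \<ge> 16\<close> this already makes the left side of \<open>large\<close> huge, so
    \<open>card V\<close> is large and \<open>\<L> \<ge> 1\<close> follows.\<close>
  have "ln (1 / 2 :: real) \<le> 1 / 2 - 1" by (rule ln_le_minus_one) simp
  then have "1 / 2 \<le> ln (2 :: real)" by (simp add: ln_div)
  also have "\<dots> \<le> \<L>" unfolding \<L>_def using n2 by (intro ln_mono) auto
  finally have L2: "1 / 2 \<le> \<L>" .
  have "(1 / 2)\<^sup>2 * (4 * 16) ^ 13 \<le> \<L>\<^sup>2 * (4 * x) ^ 13"
    using L2 x16 by (intro mult_mono power_mono) auto
  also have "\<dots> < card V" using large by (simp only: \<L>_def x_def)
  finally have "(1 / 2)\<^sup>2 * (4 * 16) ^ 13 < real (card V)" .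
  moreover have "(12 :: real) \<le> (1 / 2)\<^sup>2 * (4 * 16) ^ 13" by (simp add: power2_eq_square)
  ultimately have n12: "12 \<le> card V" by linarith
  have L1: "1 \<le> \<L>"
  proof -
    have "exp 1 \<le> real (card V)" using exp_le n12 by linarith
    then show ?thesis unfolding \<L>_def using card_bounds(2) by (simp add: ln_ge_iff)
  qed
  \<comment> \<open>The sample size must exceed \<open>256 * (x^2 * \<L>) * (x + 3)\<close>, and
    \<open>x + 3 < 2 * x\<close>. Below, \<open>t\<close> is odd with \<open>t - 1 > 4 * x\<close>;
    since \<open>x \<ge> 16\<close>, all rounding is absorbed in \<open>t \<le> 5 * x\<close> and
    \<open>K + 2 \<le> 3 * x\<close>.\<close>
  define m where "m = nat \<lceil>512 * (x ^ 3 * \<L>)\<rceil>"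
  define t where "t = 2 * nat \<lceil>2 * x\<rceil> + 3"
  define K where "K = nat \<lceil>2 * card V / \<beta>\<rceil> + 2"
  have x3: "1 \<le> x ^ 3 * \<L>"
    using mult_mono[of 1 "x ^ 3" 1 \<L>] L1 x16 by simp
  have m_lower: "512 * (x ^ 3 * \<L>) \<le> m" unfolding m_def by linarith
  have m_upper: "m \<le> 513 * (x ^ 3 * \<L>)" unfolding m_def using x3 by linarith
  have m1: "1 \<le> real m" using m_lower x3 by linarith
  have t_upper: "t \<le> 5 * x" unfolding t_def using x16 by linarith
  have t_lower: "4 * x < real (t - 1)" unfolding t_def using x16 by linarith
  have "2 * card V / \<beta> = 2 * x" by (simp add: x_def)
  then have K_upper: "K + 2 \<le> 3 * x" unfolding K_def using x16 by linarith
  have m_big: "64 * (card V / (\<beta> / 2))\<^sup>2 * (card V / \<beta> + 3) * ln (card V) < m"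
  proof -
    have "64 * (card V / (\<beta> / 2))\<^sup>2 * (card V / \<beta> + 3) * ln (card V) = 256 * (x\<^sup>2 * \<L>) * (x + 3)"
      by (simp add: x_def \<L>_def power2_eq_square field_simps)
    also have "\<dots> < 256 * (x\<^sup>2 * \<L>) * (2 * x)"
      using x16 L1 by (intro mult_strict_left_mono) auto
    also have "\<dots> = 512 * (x ^ 3 * \<L>)" by (simp add: power2_eq_square power3_eq_cube)
    finally show ?thesis using m_lower by linarith
  qed
  define y where "y = x ^ 8 * \<L>\<^sup>2"
  have y1: "1 \<le> y"
    unfolding y_def using mult_mono[of 1 "x ^ 8" 1 "\<L>\<^sup>2"] L1 x16 by simp
  have "real (Suc (2 * m) * t * m * (K + 2)) = real (Suc (2 * m)) * t * m * real (K + 2)"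
    by (simp only: of_nat_mult)
  also have "\<dots> \<le> (3 * m) * (5 * x) * m * (3 * x)"
    using m1 t_upper K_upper x16 by (intro mult_mono) auto
  also have "\<dots> = 45 * x\<^sup>2 * (real m)\<^sup>2" by (simp add: power2_eq_square)
  also have "\<dots> \<le> 45 * x\<^sup>2 * (513 * (x ^ 3 * \<L>))\<^sup>2"
    using m_upper by (intro mult_left_mono power_mono) auto
  \<comment> \<open>The constant is 45 times the square of 513.\<close>
  also have "\<dots> = 11842605 * y" by (simp add: y_def power_mult_distrib flip: power_mult power_add) 
  finally have size: "real (Suc (2 * m) * t * m * (K + 2)) \<le> 11842605 * y" .
  \<comment> \<open>Of the factor \<open>x^13\<close> in \<open>large\<close>, one \<open>x\<close>
    turns \<open>card V\<close> into \<open>\<beta>\<close>, eight form \<open>y\<close>, and the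
    other four are at least \<open>16^4 = 2^16\<close>; \<open>4^13\<close> supplies
    \<open>2^26\<close>.\<close>
  have beta: "2 ^ 42 * y \<le> \<beta>"
  proof -
    have "x * (2 ^ 42 * y) = x * (2 ^ 26 * (16 ^ 4 * x ^ 8 * \<L>\<^sup>2))" by (simp add: y_def)
    also have "\<dots> \<le> x * (2 ^ 26 * (x ^ 4 * x ^ 8 * \<L>\<^sup>2))"
      using x16 by (intro mult_left_mono mult_right_mono power_mono) auto
    also have "\<dots> = \<L>\<^sup>2 * (4 * x) ^ 13" by (simp add: power_mult_distrib flip: power_add power_Suc)
    also have "\<dots> \<le> x * \<beta>" using large Vx unfolding \<L>_def x_def by simp
    finally show ?thesis using x16 by (simp only: mult_le_cancel_left_pos)
  qed
  have "11842605 * y + 1 \<le> \<beta> / 2" using beta y1 by simp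
  then have size': "real (Suc (2 * m) * t * m * (K + 2)) + 1 \<le> \<beta> / 2" using size by linarith
  then have size'': "real (Suc (2 * m) * t * m * (K + 2)) \<le> \<beta> / 2" by linarith
  have "0 < m" using m1 by simp
  have "odd t" by (simp add: t_def)
  have "\<exists>A. absorber E V (Suc (2 * m)) A \<and> E (last A) (hd A) \<and> set A \<subseteq> V \<and>
      length A \<le> Suc (2 * m) * t * m * (K + 2)"
    unfolding K_def
    by (rule absorbing_cycle[OF \<open>0 < m\<close> m_big _ \<open>odd t\<close> t_lower[unfolded x_def] size''[unfolded K_def]])
      (use n12 in simp)
  then obtain A where A: "absorber E V (Suc (2 * m)) A" "E (last A) (hd A)" "set A \<subseteq> V"
    "length A \<le> Suc (2 * m) * t * m * (K + 2)" by blast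
  then have "real (length A) + 1 \<le> \<beta> / 2" using size' by linarith
  then show ?thesis using cycle_from_absorber[OF \<open>0 < m\<close> m_big n12 A(1-3) _ v k] by blast
qed

end

section \<open>Digraphs\<close>

lemma (in digraph) card_out_neighbours:
  "card {y \<in> verts G. x \<rightarrow>\<^bsub>G\<^esub> y} = out_degree G x"
proof -
  have "{y \<in> verts G. x \<rightarrow>\<^bsub>G\<^esub> y} = head G ` out_arcs G x"
    by (auto simp: arcs_ends_def arc_to_ends_def)
  moreover have "inj_on (head G) (out_arcs G x)"
    using no_multi_arcs by (auto intro!: inj_onI simp: arc_to_ends_def)
  ultimately show ?thesis by (simp add: out_degree_def card_image)
qed

lemma (in digraph) card_in_neighbours:
  "card {y \<in> verts G. y \<rightarrow>\<^bsub>G\<^esub> x} = in_degree G x"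
proof -
  have "{y \<in> verts G. y \<rightarrow>\<^bsub>G\<^esub> x} = tail G ` in_arcs G x"
    by (auto simp: arcs_ends_def arc_to_ends_def)
  moreover have "inj_on (tail G) (in_arcs G x)"
    using no_multi_arcs by (auto intro!: inj_onI simp: arc_to_ends_def)
  ultimately show ?thesis by (simp add: in_degree_def card_image)
qed

text \<open>The tails are recorded because \<open>has_cycle_through\<close> reads the vertices of a
  cycle off the tails of its arcs; they also yield its length.\<close>

lemma (in wf_digraph) awalk_of_dominates:
  assumes "x \<in> verts G" "successively (\<lambda>x y. x \<rightarrow>\<^bsub>G\<^esub> y) (x # zs)"
  shows "\<exists>p. awalk x p (last (x # zs)) \<and> awalk_verts x p = x # zs \<and> map (tail G) p = butlast (x # zs)"
  using assms
proof (induction zs arbitrary: x)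
  case Nil
  then show ?case by (intro exI[of _ "[]"]) (simp add: awalk_Nil_iff)
next
  case (Cons z zs)
  have xz: "x \<rightarrow>\<^bsub>G\<^esub> z" "successively (\<lambda>x y. x \<rightarrow>\<^bsub>G\<^esub> y) (z # zs)" using Cons.prems(2) by simp_all
  then obtain e where e: "e \<in> arcs G" "tail G e = x" "head G e = z"
    by (auto simp: arcs_ends_def arc_to_ends_def)
  obtain p where "awalk z p (last (z # zs))" "awalk_verts z p = z # zs" "map (tail G) p = butlast (z # zs)"
    using Cons.IH[of z] xz adj_in_verts(2)[OF xz(1)] by blast
  then show ?case using e by (intro exI[of _ "e # p"]) (simp add: awalk_Cons_iff)
qed

lemma (in wf_digraph) has_cycle_through_of_dipath:
  assumes Z: "dipath (\<lambda>x y. x \<rightarrow>\<^bsub>G\<^esub> y) Z" "last Z \<rightarrow>\<^bsub>G\<^esub> hd Z" and v: "v \<in> set Z"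
  shows "has_cycle_through G (int (length Z)) v"
proof -
  obtain x zs where xs: "Z = x # zs" using Z(1) by (cases Z) (auto simp: dipath_def)
  have "x \<in> verts G" using adj_in_verts(2)[OF Z(2)] xs by simp
  moreover have "successively (\<lambda>x y. x \<rightarrow>\<^bsub>G\<^esub> y) (x # (zs @ [x]))"
    using Z xs successively_append_iff[of _ "x # zs" "[x]"] by (simp add: dipath_def)
  ultimately obtain p where p: "awalk x p (last (x # zs @ [x]))" "awalk_verts x p = x # zs @ [x]"
    "map (tail G) p = butlast (x # zs @ [x])"
    using awalk_of_dominates[of x "zs @ [x]"] by blast
  have tails: "map (tail G) p = Z" using p(3) xs by (simp add: butlast_append)
  then have "length p = length Z" using length_map[of "tail G" p] by simp
  moreover have "v \<in> tail G ` set p" using v unfolding tails[symmetric] by simp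
  moreover have "cycle p"
    unfolding cycle_def
  proof (intro exI conjI)
    show "awalk x p x" using p(1) by simp
    show "distinct (tl (awalk_verts x p))" using p(2) Z(1) xs by (simp add: dipath_def)
    show "p \<noteq> []" using tails xs by auto
  qed
  ultimately show ?thesis unfolding has_cycle_through_def by (intro exI[of _ p]) simp
qed

theorem theorem1p3:
  fixes D :: "('a, 'b) pre_digraph" and n :: nat and \<nu> \<tau> \<gamma> :: real
  assumes "0 < \<nu>" "\<nu> < 1" "0 < \<tau>" "\<tau> < 1" "0 < \<gamma>" "\<gamma> < 1"
    and "4 * root 13 ((ln (real n))\<^sup>2 / real n) < \<nu>"
    and "\<nu> \<le> \<tau>" "\<tau> \<le> \<gamma> / 16" "\<gamma> / 16 < 1 / 16"
    and "digraph D" "card (verts D) = n"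
    and "real (min_semi_degree D) \<ge> \<gamma> * real n"
    and "robust_outexpander \<nu> \<tau> D"
  shows "\<forall>l :: int. \<forall>v \<in> verts D.
    \<nu> * real n / 2 \<le> real_of_int l \<and> l \<le> int n \<longrightarrow> has_cycle_through D l v"
proof (intro allI ballI impI)
  fix l :: int and v assume v: "v \<in> verts D" and l: "\<nu> * real n / 2 \<le> real_of_int l \<and> l \<le> int n"
  interpret digraph D by fact
  note n = \<open>card (verts D) = n\<close>
  have npos: "0 < n" using v n finite_verts card_gt_0_iff by blast
  have deg: "16 * (\<tau> * n) \<le> card {y \<in> verts D. x \<rightarrow>\<^bsub>D\<^esub> y}" "16 * (\<tau> * n) \<le> card {y \<in> verts D. y \<rightarrow>\<^bsub>D\<^esub> x}"
    if x: "x \<in> verts D" for x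
  proof -
    have "16 * (\<tau> * n) \<le> \<gamma> * n" using \<open>\<tau> \<le> \<gamma> / 16\<close> mult_right_mono[of "16 * \<tau>" \<gamma> "real n"] by simp
    moreover have "min_semi_degree D \<le> out_degree D x" "min_semi_degree D \<le> in_degree D x"
      using x finite_verts unfolding min_semi_degree_def by (auto simp: min_le_iff_disj)
    ultimately show "16 * (\<tau> * n) \<le> card {y \<in> verts D. x \<rightarrow>\<^bsub>D\<^esub> y}"
      "16 * (\<tau> * n) \<le> card {y \<in> verts D. y \<rightarrow>\<^bsub>D\<^esub> x}"
      using assms(13) by (simp_all add: card_out_neighbours card_in_neighbours)
  qed
  interpret R: robust_digraph "verts D" "\<lambda>x y. x \<rightarrow>\<^bsub>D\<^esub> y" "\<nu> * n" "\<tau> * n"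
  proof
    show "card S + \<nu> * n \<le> card {y \<in> verts D. \<nu> * n \<le> card {x \<in> S. x \<rightarrow>\<^bsub>D\<^esub> y}}"
      if "S \<subseteq> verts D" "\<tau> * n \<le> card S" "real (card S) \<le> real (card (verts D)) - \<tau> * n" for S
      using assms(14) that unfolding robust_outexpander_def robust_out_nbhd_def n
      by (simp add: left_diff_distrib)
    show "verts D \<noteq> {}" using v by blast
    show "0 < \<nu> * n" "\<nu> * n \<le> \<tau> * n" using npos \<open>0 < \<nu>\<close> \<open>\<nu> \<le> \<tau>\<close> by simp_all
    show "x \<in> verts D \<and> y \<in> verts D" if "x \<rightarrow>\<^bsub>D\<^esub> y" for x y using that by (simp add: adj_in_verts)
    show "finite (verts D)" by simp
    show "16 * (\<tau> * n) \<le> card {y \<in> verts D. x \<rightarrow>\<^bsub>D\<^esub> y}" if "x \<in> verts D" for x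
      using that by (rule deg(1))
    show "16 * (\<tau> * n) \<le> card {x \<in> verts D. x \<rightarrow>\<^bsub>D\<^esub> y}" if "y \<in> verts D" for y
      using that by (rule deg(2))
  qed
  \<comment> \<open>Positive outdegree without loops forces a second vertex.\<close>
  have "2 \<le> n"
  proof -
    have "0 < card {y \<in> verts D. v \<rightarrow>\<^bsub>D\<^esub> y}"
    proof -
      have "0 < 16 * (\<tau> * n)" using \<open>0 < \<tau>\<close> npos by simp
      then show ?thesis using deg(1)[OF v] by linarith
    qed
    then obtain y where y: "y \<in> verts D" "v \<rightarrow>\<^bsub>D\<^esub> y" by (auto simp: card_gt_0_iff)
    then have "v \<noteq> y" using no_loops by (auto simp: arcs_ends_def arc_to_ends_def)
    then have "card {v, y} = 2" by simp
    then show ?thesis using card_mono[of "verts D" "{v, y}"] v y(1) finite_verts n by simp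
  qed
  \<comment> \<open>The assumed root bound, raised to the 13th power. Here
    \<open>n / (\<nu> * n)\<close> is \<open>1 / \<nu>\<close>.\<close>
  have large: "(ln (real n))\<^sup>2 * (4 * (n / (\<nu> * n))) ^ 13 < n"
  proof -
    define r where "r = root 13 ((ln (real n))\<^sup>2 / real n)"
    have r: "0 \<le> r" "r ^ 13 = (ln (real n))\<^sup>2 / real n"
      by (auto simp: r_def odd_real_root_pow)
    have "r < \<nu> / 4" using assms(7) by (simp add: r_def)
    then have "r ^ 13 < (\<nu> / 4) ^ 13" using r(1) by (intro power_strict_mono) auto
    then have "(ln (real n))\<^sup>2 < n * (\<nu> / 4) ^ 13"
      using npos unfolding r(2) by (simp add: pos_divide_less_eq mult.commute)
    then have "(ln (real n))\<^sup>2 * (4 / \<nu>) ^ 13 < n * (\<nu> / 4) ^ 13 * (4 / \<nu>) ^ 13"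
      using \<open>0 < \<nu>\<close> by (intro mult_strict_right_mono) auto
    also have "\<dots> = n" using \<open>0 < \<nu>\<close> by (simp add: power_divide)
    finally show ?thesis using npos by simp
  qed
  \<comment> \<open>Positivity makes \<open>nat l\<close> represent \<open>l\<close>
    faithfully.\<close>
  have "0 < l"
  proof -
    have "0 < \<nu> * real n / 2" using \<open>0 < \<nu>\<close> npos by simp
    then show ?thesis using l by linarith
  qed
  then have k: "\<nu> * n / 2 \<le> real (nat l)" "nat l \<le> card (verts D)" using l n by auto
  obtain Z where "dipath (\<lambda>x y. x \<rightarrow>\<^bsub>D\<^esub> y) Z" "last Z \<rightarrow>\<^bsub>D\<^esub> hd Z" "length Z = nat l" "v \<in> set Z"
    using R.cycle_through_vertex[unfolded n, OF \<open>2 \<le> n\<close> large v k[unfolded n]] by blast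
  then show "has_cycle_through D l v" using has_cycle_through_of_dipath[of Z v] \<open>0 < l\<close> by simp
qed

end
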